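(* Let $\mathbf{k}$ be an algebraically closed field of characteristic $0$. Let $V_{4,-1,1}$ be the $4$-dimensional braided pair with basis $\{x_0,x_1,x_2,x_3\}$ and braiding $c(x_i\otimes x_j)=-x_{i\triangleright j}\otimes x_i$, where for each $i$ the map $j\mapsto i\triangleright j$ is the permutation $\pi_i$ of $\{0,1,2,3\}$ given in cycle notation by $$\pi_0=(1\ 2\ 3),\qquad \pi_1=(0\ 3\ 2),\qquad \pi_2=(0\ 1\ 3),\qquad \pi_3=(0\ 2\ 1).$$ Then the homogeneous components $\mathfrak{B}^i(V_{4,-1,1})$ of the Nichols algebra $\mathfrak{B}(V_{4,-1,1})$ have dimensions $$1,\,4,\,8,\,11,\,12,\,12,\,11,\,8,\,4,\,1$$ for $i=0,1,2,3,4,5,6,7,8,9$ respectively, and hence $\dim\mathfrak{B}(V_{4,-1,1})=72$.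
   Context: A braided pair is a pair $(V,c)$ with $V$ a vector space and $c:V\otimes V\to V\otimes V$ a bijective solution of the braid equation. Nichols algebra. The braid group $\mathbb{B}_n$ (generators $\sigma_1,\dots,\sigma_{n-1}$) acts on $V^{\otimes n}$, $\sigma_i$ acting by $c$ in positions $i,i+1$. Let $s:\mathbb{S}_n\to\mathbb{B}_n$ be the set-theoretic section sending a reduced expression $\tau_{i_1}\cdots\tau_{i_l}$ ($\tau_i=(i\ i{+}1)$) to $\sigma_{i_1}\cdots\sigma_{i_l}$, and $\mathbf{S}^n=\sum_{x\in\mathbb{S}_n}s(x)$. The Nichols algebra $\mathfrak{B}(V)=\bigoplus_n\mathfrak{B}^n(V)$ is the image of the graded map $\bigoplus_n\mathbf{S}^n$ from the tensor algebra of $V$ to the tensor coalgebra of $V$; so $\mathfrak{B}^n(V)$ is the image of $\mathbf{S}^n:V^{\otimes n}\to V^{\otimes n}$, and as an algebra $\mathfrak{B}(V)$ is the quotient of the tensor algebra by $\bigoplus_n\ker\mathbf{S}^n$. *)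

theory Defs
  imports
    "HOL-Computational_Algebra.Polynomial"
    "HOL-Combinatorics.Cycles"
    "HOL-Library.Poly_Mapping"
begin

text \<open>
  A vector space with basis indexed by \<open>'b\<close> is represented as the space \<open>'b \<Rightarrow>\<^sub>0 'k\<close> of finitely
  supported coefficient functions; the basis vector with index \<open>b\<close> is \<open>Poly_Mapping.single b 1\<close>.
  If \<open>V\<close> is \<open>'x \<Rightarrow>\<^sub>0 'k\<close>, then \<open>V \<otimes> V\<close> is \<open>'x \<times> 'x \<Rightarrow>\<^sub>0 'k\<close>, and the tensor algebra (equivalently, the
  underlying space of the tensor coalgebra) of \<open>V\<close> is \<open>'x list \<Rightarrow>\<^sub>0 'k\<close>: the word
  \<open>[a\<^sub>1, \<dots>, a\<^sub>n]\<close> stands for \<open>x\<^bsub>a\<^sub>1\<^esub> \<otimes> \<dots> \<otimes> x\<^bsub>a\<^sub>n\<^esub>\<close>.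
\<close>

definition scale :: "'k::field \<Rightarrow> ('b \<Rightarrow>\<^sub>0 'k) \<Rightarrow> ('b \<Rightarrow>\<^sub>0 'k)" where
  "scale a t = Poly_Mapping.map ((*) a) t"

lemma lookup_scale [simp]: "Poly_Mapping.lookup (scale a t) b = a * Poly_Mapping.lookup t b"
  by (simp add: scale_def Poly_Mapping.map.rep_eq when_def)

interpretation free_space: vector_space "scale :: 'k::field \<Rightarrow> ('b \<Rightarrow>\<^sub>0 'k) \<Rightarrow> ('b \<Rightarrow>\<^sub>0 'k)"
  by unfold_locales (auto intro!: poly_mapping_eqI simp: lookup_add algebra_simps)

definition lin_ext :: "('b \<Rightarrow> ('d \<Rightarrow>\<^sub>0 'k::field)) \<Rightarrow> ('b \<Rightarrow>\<^sub>0 'k) \<Rightarrow> ('d \<Rightarrow>\<^sub>0 'k)" where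
  "lin_ext f t = (\<Sum>b\<in>Poly_Mapping.keys t. scale (Poly_Mapping.lookup t b) (f b))"

definition tensor_power :: "nat \<Rightarrow> ('x list \<Rightarrow>\<^sub>0 'k::field) set" where
  "tensor_power n = {t. \<forall>w\<in>Poly_Mapping.keys t. length w = n}"

text \<open>Positions are counted from \<open>0\<close>, so \<open>braid_at c i\<close> is the usual \<open>c\<^bsub>i+1,i+2\<^esub>\<close>. It is only meaningful,
  and only used, on \<open>tensor_power n\<close> with \<open>Suc i < n\<close>.\<close>

definition braid_at ::
  "(('x \<times> 'x \<Rightarrow>\<^sub>0 'k::field) \<Rightarrow> ('x \<times> 'x \<Rightarrow>\<^sub>0 'k)) \<Rightarrow> nat \<Rightarrow> ('x list \<Rightarrow>\<^sub>0 'k) \<Rightarrow> ('x list \<Rightarrow>\<^sub>0 'k)" where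
  "braid_at c i =
     lin_ext (\<lambda>w. lin_ext (\<lambda>(a, b). Poly_Mapping.single (w[i := a, Suc i := b]) 1)
                        (c (Poly_Mapping.single (w ! i, w ! Suc i) 1)))"

definition braided_pair :: "(('x \<times> 'x \<Rightarrow>\<^sub>0 'k::field) \<Rightarrow> ('x \<times> 'x \<Rightarrow>\<^sub>0 'k)) \<Rightarrow> bool" where
  "braided_pair c \<longleftrightarrow>
     Vector_Spaces.linear scale scale c \<and> bij c \<and>
     (\<forall>t\<in>tensor_power 3.
        braid_at c 0 (braid_at c 1 (braid_at c 0 t)) = braid_at c 1 (braid_at c 0 (braid_at c 1 t)))"

definition perm_of_word :: "nat list \<Rightarrow> nat \<Rightarrow> nat" where
  "perm_of_word is = foldr (\<lambda>i p. transpose i (Suc i) \<circ> p) is id"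

text \<open>Here the symmetric group \<open>S\<^sub>n\<close> acts on \<open>{..<n}\<close>, so the simple transpositions are
  \<open>transpose i (Suc i)\<close> with \<open>Suc i < n\<close>.\<close>

definition expression_of :: "nat \<Rightarrow> (nat \<Rightarrow> nat) \<Rightarrow> nat list \<Rightarrow> bool" where
  "expression_of n x is \<longleftrightarrow> (\<forall>i\<in>set is. Suc i < n) \<and> perm_of_word is = x"

definition reduced_expression_of :: "nat \<Rightarrow> (nat \<Rightarrow> nat) \<Rightarrow> nat list \<Rightarrow> bool" where
  "reduced_expression_of n x is \<longleftrightarrow>
     expression_of n x is \<and> (\<forall>js. expression_of n x js \<longrightarrow> length is \<le> length js)"

definition braid_word_op ::
  "(('x \<times> 'x \<Rightarrow>\<^sub>0 'k::field) \<Rightarrow> ('x \<times> 'x \<Rightarrow>\<^sub>0 'k)) \<Rightarrow> nat list \<Rightarrow> ('x list \<Rightarrow>\<^sub>0 'k) \<Rightarrow> ('x list \<Rightarrow>\<^sub>0 'k)" where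
  "braid_word_op c is = foldr (\<lambda>i f. braid_at c i \<circ> f) is id"

text \<open>The action on \<open>V\<^sup>\<otimes>\<^sup>n\<close> of the image \<open>s(x)\<close> of \<open>x\<close> under the section from the symmetric group to the
  braid group. By Matsumoto's theorem it does not depend, for a braided pair, on the reduced
  expression that is chosen.\<close>

definition section_op ::
  "(('x \<times> 'x \<Rightarrow>\<^sub>0 'k::field) \<Rightarrow> ('x \<times> 'x \<Rightarrow>\<^sub>0 'k)) \<Rightarrow> nat \<Rightarrow> (nat \<Rightarrow> nat) \<Rightarrow>
     ('x list \<Rightarrow>\<^sub>0 'k) \<Rightarrow> ('x list \<Rightarrow>\<^sub>0 'k)" where
  "section_op c n x = braid_word_op c (SOME is. reduced_expression_of n x is)"

definition quantum_symmetrizer ::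
  "(('x \<times> 'x \<Rightarrow>\<^sub>0 'k::field) \<Rightarrow> ('x \<times> 'x \<Rightarrow>\<^sub>0 'k)) \<Rightarrow> nat \<Rightarrow> ('x list \<Rightarrow>\<^sub>0 'k) \<Rightarrow> ('x list \<Rightarrow>\<^sub>0 'k)" where
  "quantum_symmetrizer c n t = (\<Sum>x | x permutes {..<n}. section_op c n x t)"

definition nichols_component ::
  "(('x \<times> 'x \<Rightarrow>\<^sub>0 'k::field) \<Rightarrow> ('x \<times> 'x \<Rightarrow>\<^sub>0 'k)) \<Rightarrow> nat \<Rightarrow> ('x list \<Rightarrow>\<^sub>0 'k) set" where
  "nichols_component c n = quantum_symmetrizer c n ` tensor_power n"

text \<open>The direct sum of all quantum symmetrizers, as an endomorphism of the tensor algebra.\<close>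

definition graded_symmetrizer ::
  "(('x \<times> 'x \<Rightarrow>\<^sub>0 'k::field) \<Rightarrow> ('x \<times> 'x \<Rightarrow>\<^sub>0 'k)) \<Rightarrow> ('x list \<Rightarrow>\<^sub>0 'k) \<Rightarrow> ('x list \<Rightarrow>\<^sub>0 'k)" where
  "graded_symmetrizer c = lin_ext (\<lambda>w. quantum_symmetrizer c (length w) (Poly_Mapping.single w 1))"

definition nichols_algebra ::
  "(('x \<times> 'x \<Rightarrow>\<^sub>0 'k::field) \<Rightarrow> ('x \<times> 'x \<Rightarrow>\<^sub>0 'k)) \<Rightarrow> ('x list \<Rightarrow>\<^sub>0 'k) set" where
  "nichols_algebra c = range (graded_symmetrizer c)"

datatype tetra = X0 | X1 | X2 | X3

fun tetra_perm :: "tetra \<Rightarrow> tetra \<Rightarrow> tetra" where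
  "tetra_perm X0 = cycle_of_list [X1, X2, X3]"
| "tetra_perm X1 = cycle_of_list [X0, X3, X2]"
| "tetra_perm X2 = cycle_of_list [X0, X1, X3]"
| "tetra_perm X3 = cycle_of_list [X0, X2, X1]"

definition tetra_braiding :: "(tetra \<times> tetra \<Rightarrow>\<^sub>0 'k::field) \<Rightarrow> (tetra \<times> tetra \<Rightarrow>\<^sub>0 'k)" where
  "tetra_braiding = lin_ext (\<lambda>(i, j). - Poly_Mapping.single (tetra_perm i j, i) 1)"

subsection \<open>The tetrahedral braiding is a braiding\<close>

lemma lin_ext_superset:
  assumes "finite A" "Poly_Mapping.keys t \<subseteq> A"
  shows "lin_ext f t = (\<Sum>b\<in>A. scale (Poly_Mapping.lookup t b) (f b))"
  unfolding lin_ext_def using assms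
  by (intro sum.mono_neutral_left) (auto simp: in_keys_iff)

lemma lin_ext_single [simp]: "lin_ext f (Poly_Mapping.single b a) = scale a (f b)"
  by (subst lin_ext_superset[of "{b}"]) auto

lemma linear_lin_ext:
  fixes f :: "'b \<Rightarrow> ('d \<Rightarrow>\<^sub>0 'k::field)"
  shows "Vector_Spaces.linear scale scale (lin_ext f)"
proof (unfold_locales)
  fix s t :: "'b \<Rightarrow>\<^sub>0 'k"
  show "lin_ext f (s + t) = lin_ext f s + lin_ext f t"
    using keys_add[of s t]
    by (simp add: lin_ext_superset[of "Poly_Mapping.keys s \<union> Poly_Mapping.keys t"] lookup_add
        free_space.scale_left_distrib sum.distrib)
next
  fix a and t :: "'b \<Rightarrow>\<^sub>0 'k"
  have "Poly_Mapping.keys (scale a t) \<subseteq> Poly_Mapping.keys t" by (auto simp: in_keys_iff)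
  then show "lin_ext f (scale a t) = scale a (lin_ext f t)"
    by (simp add: lin_ext_superset[of "Poly_Mapping.keys t"] free_space.scale_sum_right)
qed

lemma poly_mapping_expand: "t = (\<Sum>b\<in>Poly_Mapping.keys t. scale (Poly_Mapping.lookup t b) (Poly_Mapping.single b 1))"
  by (rule poly_mapping_eqI)
     (auto simp: lookup_sum lookup_single when_def in_keys_iff if_distrib cong: if_cong)

lemma linear_eqI:
  assumes "Vector_Spaces.linear scale scale f" "Vector_Spaces.linear scale scale g"
    and "\<And>b. b \<in> Poly_Mapping.keys t \<Longrightarrow> f (Poly_Mapping.single b 1) = g (Poly_Mapping.single b 1)"
  shows "f t = g t"
proof -
  interpret f: Vector_Spaces.linear scale scale f by fact
  interpret g: Vector_Spaces.linear scale scale g by fact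
  let ?e = "\<Sum>b\<in>Poly_Mapping.keys t. scale (Poly_Mapping.lookup t b) (Poly_Mapping.single b 1)"
  have "f ?e = g ?e"
    unfolding f.sum f.scale g.sum g.scale by (rule sum.cong) (simp_all only: assms(3))
  then show ?thesis by (simp only: poly_mapping_expand[symmetric])
qed

lemma tetra_perm_simps:
  "tetra_perm X0 X0 = X0" "tetra_perm X0 X1 = X2" "tetra_perm X0 X2 = X3" "tetra_perm X0 X3 = X1"
  "tetra_perm X1 X0 = X3" "tetra_perm X1 X1 = X1" "tetra_perm X1 X2 = X0" "tetra_perm X1 X3 = X2"
  "tetra_perm X2 X0 = X1" "tetra_perm X2 X1 = X3" "tetra_perm X2 X2 = X2" "tetra_perm X2 X3 = X0"
  "tetra_perm X3 X0 = X2" "tetra_perm X3 X1 = X0" "tetra_perm X3 X2 = X1" "tetra_perm X3 X3 = X3"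
  by (simp_all add: transpose_def)

lemma tetra_perm_self_distributive:
  "tetra_perm i (tetra_perm j k) = tetra_perm (tetra_perm i j) (tetra_perm i k)"
  by (cases i; cases j; cases k) (simp_all only: tetra_perm_simps)

lemma tetra_perm_order_3: "tetra_perm i (tetra_perm i (tetra_perm i j)) = j"
  by (cases i; cases j) (simp_all only: tetra_perm_simps)

lemma braided_pair_tetra_braiding:
  "braided_pair (tetra_braiding :: (tetra \<times> tetra \<Rightarrow>\<^sub>0 'k::field) \<Rightarrow> _)"
proof -
  let ?c = "tetra_braiding :: (tetra \<times> tetra \<Rightarrow>\<^sub>0 'k) \<Rightarrow> _"
  have lin: "Vector_Spaces.linear scale scale ?c"
    unfolding tetra_braiding_def by (rule linear_lin_ext)
  have neg: "Vector_Spaces.linear scale scale f \<Longrightarrow> f (- t) = - f t"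
    for f :: "('b \<Rightarrow>\<^sub>0 'k) \<Rightarrow> ('d \<Rightarrow>\<^sub>0 'k)" and t
    by (rule module_hom.neg) (simp add: linear_iff_module_hom)
  define d :: "(tetra \<times> tetra \<Rightarrow>\<^sub>0 'k) \<Rightarrow> (tetra \<times> tetra \<Rightarrow>\<^sub>0 'k)"
    where "d = lin_ext (\<lambda>(a, i). - Poly_Mapping.single (i, tetra_perm i (tetra_perm i a)) 1)"
  have lind: "Vector_Spaces.linear scale scale d"
    unfolding d_def by (rule linear_lin_ext)
  note lin_id = free_space.linear_id[unfolded id_def]
  have c1: "?c (Poly_Mapping.single (i, j) 1) = - Poly_Mapping.single (tetra_perm i j, i) 1" for i j
    by (simp add: tetra_braiding_def)
  have d1: "d (Poly_Mapping.single (a, i) 1) = - Poly_Mapping.single (i, tetra_perm i (tetra_perm i a)) 1" for a i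
    by (simp add: d_def)
  have dc: "d (?c t) = t" for t
  proof (rule linear_eqI[of "\<lambda>t. d (?c t)" "\<lambda>t. t"])
    show "Vector_Spaces.linear scale scale (\<lambda>t. d (?c t))"
      using Vector_Spaces.linear_compose[OF lin lind] by (simp only: o_def)
    show "Vector_Spaces.linear scale scale (\<lambda>t :: tetra \<times> tetra \<Rightarrow>\<^sub>0 'k. t)"
      by (rule lin_id)
    show "d (?c (Poly_Mapping.single x 1)) = Poly_Mapping.single x 1" for x
      by (cases x) (simp only: c1 d1 neg[OF lind] minus_minus tetra_perm_order_3)
  qed
  have cd: "?c (d t) = t" for t
  proof (rule linear_eqI[of "\<lambda>t. ?c (d t)" "\<lambda>t. t"])
    show "Vector_Spaces.linear scale scale (\<lambda>t. ?c (d t))"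
      using Vector_Spaces.linear_compose[OF lind lin] by (simp only: o_def)
    show "Vector_Spaces.linear scale scale (\<lambda>t :: tetra \<times> tetra \<Rightarrow>\<^sub>0 'k. t)"
      by (rule lin_id)
    show "?c (d (Poly_Mapping.single x 1)) = Poly_Mapping.single x 1" for x
      by (cases x) (simp only: c1 d1 neg[OF lin] minus_minus tetra_perm_order_3)
  qed
  have bij: "bij ?c" by (rule o_bij[of d]) (auto simp: dc cd)
  have linb: "Vector_Spaces.linear scale scale (braid_at ?c i)" for i
    unfolding braid_at_def by (rule linear_lin_ext)
  have b1: "braid_at ?c i (Poly_Mapping.single w 1) =
      - Poly_Mapping.single (w[i := tetra_perm (w ! i) (w ! Suc i), Suc i := w ! i]) 1" for i w
    by (simp add: braid_at_def c1 neg[OF linear_lin_ext])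
  have "braid_at ?c 0 (braid_at ?c 1 (braid_at ?c 0 t)) =
        braid_at ?c 1 (braid_at ?c 0 (braid_at ?c 1 t))" if "t \<in> tensor_power 3" for t
  proof (rule linear_eqI[of "\<lambda>t. braid_at ?c 0 (braid_at ?c 1 (braid_at ?c 0 t))"
           "\<lambda>t. braid_at ?c 1 (braid_at ?c 0 (braid_at ?c 1 t))"])
    fix w assume "w \<in> Poly_Mapping.keys t"
    with that have "length w = 3" by (auto simp: tensor_power_def)
    then obtain i j k where w: "w = [i, j, k]"
      by (auto simp: length_Suc_conv numeral_3_eq_3)
    show "braid_at ?c 0 (braid_at ?c 1 (braid_at ?c 0 (Poly_Mapping.single w 1))) =
          braid_at ?c 1 (braid_at ?c 0 (braid_at ?c 1 (Poly_Mapping.single w 1)))"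
      by (simp add: w b1 neg[OF linb] tetra_perm_self_distributive[of i j k])
  qed (use Vector_Spaces.linear_compose[OF Vector_Spaces.linear_compose[OF linb linb] linb]
       in \<open>simp_all only: o_def\<close>)
  with lin bij show ?thesis unfolding braided_pair_def by blast
qed

end

theory Submission
  imports Defs
begin

text \<open>
  The dimension of the image of the quantum symmetrizer is found by identifying its kernel with the
  kernel of an explicit surjection onto a graded space \<open>M\<close> with a basis of 72 words.

  The symmetrizer \<open>S\<^bsub>n+1\<^esub>\<close> factors through the skew derivations \<open>\<partial>\<^sub>a\<close> of the tensor algebra, which
  move a letter \<open>x\<^sub>a\<close> to the last place and strip it off: \<open>S\<^bsub>n+1\<^esub> t = \<Sum>\<^sub>a S\<^bsub>n\<^esub>(\<partial>\<^sub>a t) \<otimes> x\<^sub>a\<close>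
  (\<open>symmetrizer_Suc\<close>). Hence \<open>t\<close> of degree \<open>n + 1\<close> is in the kernel if and only if all \<open>\<partial>\<^sub>a t\<close> are in
  the kernel in degree \<open>n\<close>. The factorization needs the value of the section on products of a
  permutation of \<open>n\<close> letters with a coset representative. This value is independent of reduced
  expressions because a minimal positive braid acts on words by a formula in its permutation alone
  (\<open>nth_foldr_cross\<close>): the final colour of a strand is given by the original colours of the strands
  that pass over it.

  The space \<open>M\<close> is spanned by the normal words of a Groebner basis of the ideal of relations. Right
  multiplication by the letters makes \<open>M\<close> a module over the tensor algebra, and \<open>evaluate\<close> is the
  action on the empty word. Three facts about finite tables are checked by rewriting. The skew
  derivations descend to \<open>M\<close>, which by the Leibniz rule is the identity \<open>check_skew_leibniz\<close> on
  normal words. Their joint kernel on \<open>M\<close> is trivial in positive degree (\<open>check_pairing\<close>). Every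
  normal word is the value of \<open>evaluate\<close> at itself (\<open>check_tails\<close>), so that \<open>evaluate\<close> is onto. The
  first two facts show that the kernel of \<open>evaluate\<close> obeys the same recursion over the degree as the
  kernel of the symmetrizer (\<open>symmetrizer_eq_0_iff_evaluate\<close>). The two kernels are equal, and the
  dimensions are obtained by counting normal words.
\<close>

section \<open>Linear extensions\<close>

interpretation lin_ext: Vector_Spaces.linear scale scale "lin_ext f" for f
  by (rule linear_lin_ext)

lemma lin_ext_compose: "lin_ext f (lin_ext g t) = lin_ext (\<lambda>b. lin_ext f (g b)) t"
  unfolding lin_ext_def[of g] lin_ext.sum lin_ext.scale by (simp add: lin_ext_def)

lemma lin_ext_eqI:
  assumes "\<And>b. b \<in> Poly_Mapping.keys t \<Longrightarrow> f b = g b"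
  shows "lin_ext f t = lin_ext g t"
  using assms by (auto simp: lin_ext_def intro: sum.cong)

lemma lin_ext_single_1: "lin_ext (\<lambda>w. Poly_Mapping.single w 1) t = t"
  unfolding lin_ext_def by (rule poly_mapping_expand[symmetric])

lemma scale_single [simp]: "scale a (Poly_Mapping.single w b) = Poly_Mapping.single w (a * b)"
  by (rule poly_mapping_eqI) (simp add: lookup_single when_def)

section \<open>The colours of a positive permutation braid\<close>

abbreviation rack_act :: "tetra \<Rightarrow> tetra \<Rightarrow> tetra" (infixr "\<rhd>" 75) where
  "i \<rhd> j \<equiv> tetra_perm i j"

definition cross :: "nat \<Rightarrow> tetra list \<Rightarrow> tetra list" where
  "cross k w = w[k := w ! k \<rhd> w ! Suc k, Suc k := w ! k]"

lemma length_cross [simp]: "length (cross k w) = length w"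
  by (simp add: cross_def)

lemma nth_cross:
  assumes "Suc k < length w"
  shows "cross k w ! k = w ! k \<rhd> w ! Suc k" "cross k w ! Suc k = w ! k"
    "m \<noteq> k \<Longrightarrow> m \<noteq> Suc k \<Longrightarrow> cross k w ! m = w ! m"
  using assms by (simp_all add: cross_def)

lemma length_foldr_cross [simp]: "length (foldr cross ks w) = length w"
  by (induction ks) auto

lemma braid_at_single:
  "braid_at tetra_braiding k (Poly_Mapping.single w a) = Poly_Mapping.single (cross k w) (- a)"
  by (simp add: braid_at_def tetra_braiding_def lin_ext.neg single_uminus cross_def)

lemma braid_word_op_single:
  "braid_word_op tetra_braiding ks (Poly_Mapping.single w a) =
     Poly_Mapping.single (foldr cross ks w) ((-1) ^ length ks * a)"
  by (induction ks) (simp_all add: braid_word_op_def braid_at_single)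

definition inversions :: "nat \<Rightarrow> (nat \<Rightarrow> nat) \<Rightarrow> (nat \<times> nat) set" where
  "inversions n x = {(i, j). i < j \<and> j < n \<and> x j < x i}"

lemma finite_inversions [simp]: "finite (inversions n x)"
  by (rule finite_subset[of _ "{..<n} \<times> {..<n}"]) (auto simp: inversions_def)

text \<open>
  In a positive braid every crossing lets the left strand pass over unchanged and acts with its
  colour on the strand below. If the braid is minimal, a strand \<open>j\<close> passes exactly once under each
  strand \<open>i < j\<close> with \<open>x j < x i\<close>, and its final colour is obtained by letting the \<^emph>\<open>original\<close>
  colours of those strands act in order. As this expression depends on \<open>x\<close> only, it makes the choice
  of a reduced expression irrelevant and replaces Matsumoto's theorem.
\<close>

definition colour :: "(nat \<Rightarrow> nat) \<Rightarrow> tetra list \<Rightarrow> nat \<Rightarrow> tetra" where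
  "colour x w j = foldr tetra_perm (map ((!) w) (filter (\<lambda>i. x j < x i) [0..<j])) (w ! j)"

lemma foldr_rack_act:
  "foldr tetra_perm l (a \<rhd> b) = foldr tetra_perm l a \<rhd> foldr tetra_perm l b"
  by (induction l) (auto simp: tetra_perm_self_distributive[symmetric] simp del: tetra_perm.simps)

lemma perm_of_word_Cons: "perm_of_word (k # ks) = transpose k (Suc k) \<circ> perm_of_word ks"
  by (simp add: perm_of_word_def)

lemma expression_of_Cons:
  assumes "expression_of n x (k # ks)"
  shows "Suc k < n" "expression_of n (perm_of_word ks) ks"
    "x = transpose k (Suc k) \<circ> perm_of_word ks"
  using assms by (auto simp: expression_of_def perm_of_word_Cons)

lemma expression_of_permutes:
  "expression_of n x ks \<Longrightarrow> x permutes {..<n}"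
proof (induction ks arbitrary: x)
  case Nil
  then have "x = id" by (simp add: expression_of_def perm_of_word_def)
  then show ?case by (simp only: permutes_id)
next
  case (Cons k ks)
  note e = expression_of_Cons[OF Cons.prems]
  have "transpose k (Suc k) permutes {..<n}"
    using e(1) by (intro permutes_swap_id) auto
  then show ?case
    unfolding e(3) using Cons.IH[OF e(2)] by (rule permutes_compose[rotated])
qed

lemma inversions_transpose:
  assumes x: "x permutes {..<n}" and k: "Suc k < n"
    and i: "x i = k" and j: "x j = Suc k" and ij: "i < j"
  shows "inversions n (transpose k (Suc k) \<circ> x) = insert (i, j) (inversions n x)"
    "(i, j) \<notin> inversions n x"
proof -
  have inj: "x a = x b \<longleftrightarrow> a = b" for a b
    using permutes_inj[OF x] by (auto dest: injD)
  have jn: "j < n" using permutes_in_image[OF x, of j] j k by auto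
  have a: "x l = k \<longleftrightarrow> l = i" "x l = Suc k \<longleftrightarrow> l = j" for l
    using inj i j by metis+
  have t: "transpose k (Suc k) (x q) < transpose k (Suc k) (x p) \<longleftrightarrow>
      (p = i \<and> q = j) \<or> (x q < x p \<and> \<not> (p = j \<and> q = i))" for p q
    using a[of p] a[of q] ij i j by (auto simp: transpose_def)
  show "inversions n (transpose k (Suc k) \<circ> x) = insert (i, j) (inversions n x)"
    unfolding inversions_def using ij jn by (auto simp: t)
  show "(i, j) \<notin> inversions n x"
    using i j by (simp add: inversions_def)
qed

text \<open>
  A simple transposition either creates the single inversion \<open>(i, j)\<close> or destroys one; the second
  case is the first one read backwards.
\<close>

lemma card_inversions_transpose:
  assumes x: "x permutes {..<n}" and k: "Suc k < n"
  obtains i j where "x i = k" "x j = Suc k" "i < j"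
      "card (inversions n (transpose k (Suc k) \<circ> x)) = Suc (card (inversions n x))"
    | "card (inversions n (transpose k (Suc k) \<circ> x)) < card (inversions n x)"
proof -
  have surj: "\<exists>i. x i = m" for m using permutes_surj[OF x] by (metis surj_def)
  obtain i j where i: "x i = k" and j: "x j = Suc k" using surj by blast
  have "i \<noteq> j" using i j by auto
  then consider "i < j" | "j < i" by linarith
  then show ?thesis
  proof cases
    case 1
    then show ?thesis using inversions_transpose[OF x k i j] i j that(1) by simp
  next
    case 2
    let ?y = "transpose k (Suc k) \<circ> x"
    have y: "?y permutes {..<n}"
      using x k by (intro permutes_compose permutes_swap_id) auto
    have "transpose k (Suc k) \<circ> ?y = x" by (auto simp: fun_eq_iff)
    then show ?thesis
      using inversions_transpose[OF y k, of j i] i j 2 that(2) by simp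
  qed
qed

lemma card_inversions_le_length:
  "expression_of n x ks \<Longrightarrow> card (inversions n x) \<le> length ks"
proof (induction ks arbitrary: x)
  case Nil
  then have "x = id" by (simp add: expression_of_def perm_of_word_def)
  then have "inversions n x = {}" by (auto simp: inversions_def)
  then show ?case by simp
next
  case (Cons k ks)
  note e = expression_of_Cons[OF Cons.prems]
  show ?case
    unfolding e(3) using Cons.IH[OF e(2)]
    by (rule_tac card_inversions_transpose[OF expression_of_permutes[OF e(2)] e(1)]) (auto simp: o_def)
qed

text \<open>
  The strands that have passed over \<open>i\<close> are exactly the strands left of \<open>i\<close> that have passed over \<open>j\<close>.
  Their common action therefore factors out of both colours, and by self-distributivity the new
  crossing has the same effect as inserting the original colour of \<open>i\<close> in the list of \<open>j\<close>.
\<close>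

lemma colour_transpose:
  assumes x: "x permutes {..<n}" and i: "x i = k" and j: "x j = Suc k" and ij: "i < j"
  defines "y \<equiv> transpose k (Suc k) \<circ> x"
  shows "colour y w j = colour x w i \<rhd> colour x w j"
    "l \<noteq> j \<Longrightarrow> colour y w l = colour x w l"
proof -
  have inj: "x a = x b \<longleftrightarrow> a = b" for a b
    using permutes_inj[OF x] by (auto dest: injD)
  have a: "x l = k \<longleftrightarrow> l = i" "x l = Suc k \<longleftrightarrow> l = j" for l
    using inj i j by metis+
  show "colour y w l = colour x w l" if "l \<noteq> j"
  proof -
    have "filter (\<lambda>m. y l < y m) [0..<l] = filter (\<lambda>m. x l < x m) [0..<l]"
    proof (rule filter_cong)
      show "y l < y m \<longleftrightarrow> x l < x m" if "m \<in> set [0..<l]" for m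
        using that \<open>l \<noteq> j\<close> a[of m] a[of l] i j ij by (auto simp: y_def transpose_def)
    qed simp
    then show ?thesis by (simp add: colour_def)
  qed
  \<comment> \<open>The new over-strand \<open>i\<close> splits the strands passing over \<open>j\<close> into those left and right of it.\<close>
  have split: "[0..<j] = [0..<i] @ i # [Suc i..<j]"
    using ij upt_add_eq_append[of 0 i "j - i"] upt_conv_Cons[OF ij] by simp
  let ?A = "filter (\<lambda>m. x i < x m) [0..<i]" and ?B = "filter (\<lambda>m. x j < x m) [Suc i..<j]"
  have 1: "filter (\<lambda>m. x j < x m) [0..<i] = ?A"
  proof (rule filter_cong)
    show "x j < x m \<longleftrightarrow> x i < x m" if "m \<in> set [0..<i]" for m
      using that ij a(2)[of m] i j by auto
  qed simp
  have 2: "filter (\<lambda>m. y j < y m) [0..<i] = ?A"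
    by (rule filter_cong) (use ij a in \<open>auto simp: y_def transpose_def i j\<close>)
  have 3: "filter (\<lambda>m. y j < y m) [Suc i..<j] = ?B"
  proof (rule filter_cong)
    show "y j < y m \<longleftrightarrow> x j < x m" if "m \<in> set [Suc i..<j]" for m
      using that ij a[of m] i j by (auto simp: y_def transpose_def)
  qed simp
  have 4: "y j < y i" "\<not> x j < x i" using i j by (auto simp: y_def)
  show "colour y w j = colour x w i \<rhd> colour x w j"
    unfolding colour_def split filter_append filter.simps 1 2 3 using 4
    by (simp add: foldr_rack_act del: tetra_perm.simps)
qed

lemma nth_foldr_cross:
  assumes "expression_of n x ks" "length ks = card (inversions n x)" "length w = n" "l < n"
  shows "foldr cross ks w ! x l = colour x w l"
  using assms
proof (induction ks arbitrary: x l)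
  case Nil
  then have "x = id" by (simp add: expression_of_def perm_of_word_def)
  then show ?case by (simp add: colour_def)
next
  case (Cons k ks)
  let ?y = "perm_of_word ks" and ?v = "foldr cross ks w"
  note e = expression_of_Cons[OF Cons.prems(1)]
  note le = card_inversions_le_length[OF e(2)]
  note y = expression_of_permutes[OF e(2)]
  show ?case
  proof (rule card_inversions_transpose[OF y e(1)])
    fix i j
    assume i: "?y i = k" and j: "?y j = Suc k" and ij: "i < j"
      and c: "card (inversions n (transpose k (Suc k) \<circ> ?y)) = Suc (card (inversions n ?y))"
    have jn: "j < n" using permutes_in_image[OF y, of j] j e(1) by auto
    have len: "length ks = card (inversions n ?y)"
      using c Cons.prems(2) unfolding e(3) by (simp add: o_def)
    have IH: "?v ! ?y m = colour ?y w m" if "m < n" for m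
      using Cons.IH[OF e(2) len Cons.prems(3) that] .
    note col = colour_transpose[OF y i j ij, where w = w, folded e(3)]
    have v: "?v ! k = colour ?y w i" "?v ! Suc k = colour ?y w j"
      using IH[of i] IH[of j] i j ij jn by auto
    have kn: "Suc k < length ?v" using e(1) Cons.prems(3) by simp
    consider "l = j" | "l = i" | "?y l \<noteq> k" "?y l \<noteq> Suc k" "l \<noteq> j"
      using i j permutes_inj[OF y] by (metis injD)
    then show ?thesis
    proof cases
      case 1
      then have "x l = k" using j by (simp add: e(3))
      then show ?thesis using col(1) v 1 by (simp add: nth_cross[OF kn])
    next
      case 2
      then have "x l = Suc k" using i by (simp add: e(3))
      then show ?thesis using col(2) v 2 ij by (simp add: nth_cross[OF kn])
    next
      case 3
      then have "x l = ?y l" by (simp add: e(3) transpose_def)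
      then show ?thesis using col(2) 3 IH[OF Cons.prems(4)] by (simp add: nth_cross[OF kn])
    qed
  next
    assume "card (inversions n (transpose k (Suc k) \<circ> ?y)) < card (inversions n ?y)"
    then show ?thesis using le Cons.prems(2) by (simp add: e(3) o_def)
  qed
qed

lemma foldr_cross_unique:
  assumes "expression_of n x ks" "length ks = card (inversions n x)"
    and "expression_of n x js" "length js = card (inversions n x)" and "length w = n"
  shows "foldr cross ks w = foldr cross js w"
proof (rule nth_equalityI)
  fix m assume "m < length (foldr cross ks w)"
  then have "inv x m < n" "x (inv x m) = m"
    using permutes_in_image[OF permutes_inv[OF expression_of_permutes[OF assms(1)]], of m] assms(5)
      permutes_inverses(1)[OF expression_of_permutes[OF assms(1)]] by auto
  then show "foldr cross ks w ! m = foldr cross js w ! m"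
    using nth_foldr_cross[OF assms(1,2,5)] nth_foldr_cross[OF assms(3,4,5)] by metis
qed simp

section \<open>Splitting off the last tensor factor\<close>

lemma perm_of_word_append: "perm_of_word (ks @ js) = perm_of_word ks \<circ> perm_of_word js"
proof (induction ks)
  case Nil
  show ?case by (simp add: perm_of_word_def)
next
  case (Cons k ks)
  then show ?case by (simp add: perm_of_word_Cons comp_assoc)
qed

text \<open>
  The permutations \<open>move_to n k\<close>, which carry \<open>k\<close> to the last place \<open>n\<close> and keep the order of all
  others, are the minimal coset representatives of the symmetric group on \<open>{..<n}\<close> in the one on
  \<open>{..<Suc n}\<close>.
\<close>

definition move_to :: "nat \<Rightarrow> nat \<Rightarrow> nat \<Rightarrow> nat" where
  "move_to n k m = (if m = k then n else if k < m \<and> m \<le> n then m - 1 else m)"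

lemma perm_of_word_descending:
  assumes "k \<le> n"
  shows "perm_of_word (rev [k..<n]) = move_to n k"
  using assms
proof (induction n rule: dec_induct)
  case base
  show ?case by (auto simp: perm_of_word_def move_to_def fun_eq_iff)
next
  case (step n)
  then show ?case
    by (auto simp: perm_of_word_Cons fun_eq_iff move_to_def transpose_def)
qed

lemma expression_of_append_descending:
  assumes "expression_of n y ks" "k \<le> n"
  shows "expression_of (Suc n) (y \<circ> move_to n k) (ks @ rev [k..<n])"
  using assms by (auto simp: expression_of_def perm_of_word_append perm_of_word_descending)

lemma permutes_move_to: "k \<le> n \<Longrightarrow> move_to n k permutes {..<Suc n}"
  using expression_of_permutes[of "Suc n" "id \<circ> move_to n k" "[] @ rev [k..<n]"]
    expression_of_append_descending[of n id "[]" k]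
  by (simp add: expression_of_def perm_of_word_def)

lemma card_inversions_move_to:
  assumes y: "y permutes {..<n}" and k: "k \<le> n"
  shows "card (inversions n y) + (n - k) \<le> card (inversions (Suc n) (y \<circ> move_to n k))"
proof -
  \<comment> \<open>\<open>d\<close> is the increasing enumeration of all places except \<open>k\<close>, so that \<open>y \<circ> move_to n k \<circ> d\<close> agrees with \<open>y\<close> below \<open>n\<close>.\<close>
  define d where "d = (\<lambda>i. if i < k then i else Suc i)"
  have d: "move_to n k (d i) = i" if "i < n" for i
    using that by (auto simp: d_def move_to_def)
  have dmono: "d i < d j \<longleftrightarrow> i < j" "d i = d j \<longleftrightarrow> i = j" "d i \<noteq> k" for i j
    by (auto simp: d_def)
  have dn: "d i < Suc n" if "i < n" for i using that by (simp add: d_def)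
  have yn: "y n = n" using y by (simp add: permutes_def)
  have yless: "y i < n" if "i < n" for i using permutes_in_image[OF y, of i] that by simp
  let ?A = "map_prod d d ` inversions n y" and ?B = "{k} \<times> {k<..n}"
  have "?A \<subseteq> inversions (Suc n) (y \<circ> move_to n k)"
    by (auto simp: inversions_def d dmono dn)
  moreover have "?B \<subseteq> inversions (Suc n) (y \<circ> move_to n k)"
    by (auto simp: inversions_def move_to_def yn intro!: yless)
  ultimately have "card (?A \<union> ?B) \<le> card (inversions (Suc n) (y \<circ> move_to n k))"
    by (intro card_mono) auto
  moreover have "?A \<inter> ?B = {}" using dmono(3) by (auto simp: eq_commute)
  moreover have "card ?A = card (inversions n y)"
    by (rule card_image) (auto simp: inj_on_def dmono)
  ultimately show ?thesis by (simp add: card_Un_disjoint)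
qed

lemma minimal_word_append_descending:
  assumes "expression_of n y ks" "length ks = card (inversions n y)" "k \<le> n"
  shows "length (ks @ rev [k..<n]) = card (inversions (Suc n) (y \<circ> move_to n k))"
  using card_inversions_move_to[OF expression_of_permutes[OF assms(1)] assms(3)] assms(2)
    card_inversions_le_length[OF expression_of_append_descending[OF assms(1,3)]] by simp

lemma bij_betw_move_to:
  "bij_betw (\<lambda>(k, y). y \<circ> move_to n k) ({..n} \<times> {y. y permutes {..<n}}) {x. x permutes {..<Suc n}}"
  unfolding bij_betw_def
proof
  have fix_n: "y n = n" if "y permutes {..<n}" for y using that by (simp add: permutes_def)
  show "inj_on (\<lambda>(k, y). y \<circ> move_to n k) ({..n} \<times> {y. y permutes {..<n}})"
  proof (rule inj_onI, clarsimp)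
    fix k y k' y'
    assume k: "k \<le> n" "k' \<le> n" and y: "y permutes {..<n}" "y' permutes {..<n}"
      and eq: "y \<circ> move_to n k = y' \<circ> move_to n k'"
    have "y' (move_to n k' k) = y (move_to n k k)" using eq by (metis comp_apply)
    also have "\<dots> = y' n" using y by (simp add: move_to_def fix_n)
    finally have "move_to n k' k = n" using permutes_inj[OF y(2)] by (auto dest: injD)
    then have "k = k'" using k by (auto simp: move_to_def split: if_splits)
    moreover have "y = y'"
      using eq permutes_surj[OF permutes_move_to[OF k(1)]] \<open>k = k'\<close> by (metis surj_fun_eq)
    ultimately show "k = k' \<and> y = y'" by simp
  qed
  show "(\<lambda>(k, y). y \<circ> move_to n k) ` ({..n} \<times> {y. y permutes {..<n}}) = {x. x permutes {..<Suc n}}"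
  proof (intro equalityI subsetI)
    fix x assume "x \<in> {x. x permutes {..<Suc n}}"
    then have x: "x permutes {..<Suc n}" by simp
    obtain k where k: "x k = n" using permutes_surj[OF x] by (metis surj_def)
    then have kn: "k \<le> n" using permutes_in_image[OF x, of k] by auto
    let ?r = "move_to n k"
    note r = permutes_move_to[OF kn]
    have "inv ?r n = k"
      by (rule inv_f_eq[OF permutes_inj[OF r]]) (simp add: move_to_def)
    then have "(x \<circ> inv ?r) permutes {..<n}"
      using k by (intro permutes_superset[OF permutes_compose[OF permutes_inv[OF r] x]])
        (auto simp: less_Suc_eq)
    moreover have "x = x \<circ> inv ?r \<circ> ?r"
      using permutes_inv_o(2)[OF r] by (simp add: o_assoc[symmetric])
    ultimately show "x \<in> (\<lambda>(k, y). y \<circ> move_to n k) ` ({..n} \<times> {y. y permutes {..<n}})"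
      using kn by (intro image_eqI[of _ _ "(k, x \<circ> inv ?r)"]) auto
  qed (auto intro!: permutes_compose permutes_move_to intro: permutes_subset)
qed

lemma minimal_word_exists:
  "x permutes {..<n} \<Longrightarrow> \<exists>ks. expression_of n x ks \<and> length ks = card (inversions n x)"
proof (induction n arbitrary: x)
  case 0
  then have "expression_of 0 x [] \<and> length [] = card (inversions 0 x)"
    by (simp add: expression_of_def perm_of_word_def inversions_def)
  then show ?case by blast
next
  case (Suc n)
  then obtain k y where "k \<le> n" "y permutes {..<n}" "x = y \<circ> move_to n k"
    using bij_betw_imp_surj_on[OF bij_betw_move_to[of n]] by force
  then show ?case
    using Suc.IH[of y] expression_of_append_descending minimal_word_append_descending by metis
qed

text \<open>
  A word with as many letters as there are inversions is reduced, and conversely, so the reduced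
  expression that \<open>section_op\<close> selects may be replaced by any such word.
\<close>

lemma section_op_single:
  assumes "expression_of n x ks" "length ks = card (inversions n x)" "length w = n"
  shows "section_op tetra_braiding n x (Poly_Mapping.single w a) =
    Poly_Mapping.single (foldr cross ks w) ((-1) ^ length ks * a)"
proof -
  let ?js = "SOME js. reduced_expression_of n x js"
  have "reduced_expression_of n x ks"
    using assms(1,2) card_inversions_le_length by (auto simp: reduced_expression_of_def)
  then have red: "reduced_expression_of n x ?js" by (rule someI)
  then have js: "expression_of n x ?js" by (simp add: reduced_expression_of_def)
  have "length ?js \<le> length ks" using red assms(1) by (simp add: reduced_expression_of_def)
  then have "length ?js = card (inversions n x)"
    using card_inversions_le_length[OF js] assms(2) by simp
  then show ?thesis
    using foldr_cross_unique[OF assms(1,2) js _ assms(3)] assms(2)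
    by (simp add: section_op_def braid_word_op_single)
qed

lemma cross_append: "Suc k < length w \<Longrightarrow> cross k (w @ v) = cross k w @ v"
  by (simp add: cross_def list_update_append nth_append del: tetra_perm.simps)

lemma foldr_cross_append:
  "\<forall>k\<in>set ks. Suc k < length w \<Longrightarrow> foldr cross ks (w @ v) = foldr cross ks w @ v"
  by (induction ks) (auto simp: cross_append)

lemma foldr_cross_descending:
  "foldr cross (rev [length u..<length u + length v]) (u @ a # v) = u @ map (tetra_perm a) v @ [a]"
proof (induction v rule: rev_induct)
  case (snoc b v)
  have "foldr cross (rev [length u..<length u + length v]) ((u @ a # v) @ [b]) =
      (u @ map (tetra_perm a) v @ [a]) @ [b]"
    by (subst foldr_cross_append) (auto simp: snoc.IH)
  moreover have "cross (length (u @ map (tetra_perm a) v)) ((u @ map (tetra_perm a) v) @ [a, b]) =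
      (u @ map (tetra_perm a) v) @ [a \<rhd> b, a]"
    unfolding cross_def by (simp del: length_append append_assoc add: list_update_append nth_append)
  ultimately show ?case by simp
qed simp

definition pull_out :: "nat \<Rightarrow> tetra list \<Rightarrow> tetra list" where
  "pull_out k w = take k w @ map (tetra_perm (w ! k)) (drop (Suc k) w)"

lemma length_pull_out: "k < length w \<Longrightarrow> length (pull_out k w) = length w - 1"
  by (simp add: pull_out_def)

definition append_letter :: "tetra \<Rightarrow> (tetra list \<Rightarrow>\<^sub>0 'k::field) \<Rightarrow> (tetra list \<Rightarrow>\<^sub>0 'k)" where
  "append_letter a = lin_ext (\<lambda>w. Poly_Mapping.single (w @ [a]) 1)"

abbreviation symmetrizer :: "nat \<Rightarrow> (tetra list \<Rightarrow>\<^sub>0 'k::field) \<Rightarrow> (tetra list \<Rightarrow>\<^sub>0 'k)" where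
  "symmetrizer \<equiv> quantum_symmetrizer tetra_braiding"

text \<open>
  Coset by coset, the symmetrizer first moves one letter to the last place and then symmetrizes the
  remaining letters: \<open>S\<^bsub>n+1\<^esub> = (S\<^bsub>n\<^esub> \<otimes> id) (1 + \<sigma>\<^bsub>n\<^esub> + \<sigma>\<^bsub>n\<^esub> \<sigma>\<^bsub>n-1\<^esub> + \<dots>)\<close>.
\<close>

lemma symmetrizer_single:
  assumes w: "length w = Suc n"
  shows "symmetrizer (Suc n) (Poly_Mapping.single w 1) =
    (\<Sum>k\<le>n. append_letter (w ! k) (symmetrizer n (Poly_Mapping.single (pull_out k w) ((-1) ^ (n - k)))))"
proof -
  have "section_op tetra_braiding (Suc n) (y \<circ> move_to n k) (Poly_Mapping.single w 1) =
      append_letter (w ! k) (section_op tetra_braiding n y (Poly_Mapping.single (pull_out k w) ((-1) ^ (n - k))))"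
    if k: "k \<le> n" and y: "y permutes {..<n}" for k y
  proof -
    obtain ks where ks: "expression_of n y ks" "length ks = card (inversions n y)"
      using minimal_word_exists[OF y] by blast
    have "foldr cross (rev [k..<n]) w = pull_out k w @ [w ! k]"
      using foldr_cross_descending[of "take k w" "drop (Suc k) w" "w ! k"] w k
      by (simp add: pull_out_def id_take_nth_drop[symmetric] Suc_diff_le)
    moreover have "\<forall>k\<in>set ks. Suc k < n" using ks(1) by (simp add: expression_of_def)
    ultimately have "foldr cross (ks @ rev [k..<n]) w = foldr cross ks (pull_out k w) @ [w ! k]"
      using foldr_cross_append[of ks "pull_out k w" "[w ! k]"] length_pull_out[of k w] w k by simp
    moreover have "length (pull_out k w) = n" using length_pull_out[of k w] w k by simp
    ultimately show ?thesis
      by (simp add: section_op_single[OF ks] append_letter_def power_add w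
          section_op_single[OF expression_of_append_descending[OF ks(1) k]
            minimal_word_append_descending[OF ks k]] del: foldr_append length_append)
         (simp add: power_add)
  qed
  then have "symmetrizer (Suc n) (Poly_Mapping.single w 1) =
      (\<Sum>(k, y)\<in>{..n} \<times> {y. y permutes {..<n}}. append_letter (w ! k)
        (section_op tetra_braiding n y (Poly_Mapping.single (pull_out k w) ((-1) ^ (n - k)))))"
    unfolding quantum_symmetrizer_def
    by (subst sum.reindex_bij_betw[OF bij_betw_move_to, symmetric]) (auto intro!: sum.cong)
  then show ?thesis
    by (simp add: quantum_symmetrizer_def append_letter_def lin_ext.sum sum.cartesian_product)
qed

lemma lin_ext_sum_fun: "lin_ext (\<lambda>w. \<Sum>i\<in>I. f i w) t = (\<Sum>i\<in>I. lin_ext (f i) t)"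
  unfolding lin_ext_def free_space.scale_sum_right by (rule sum.swap)

lemma symmetrizer_lin_ext:
  "symmetrizer n = lin_ext (\<lambda>w. symmetrizer n (Poly_Mapping.single w 1))"
proof
  fix t :: "tetra list \<Rightarrow>\<^sub>0 'k::field"
  have "braid_word_op tetra_braiding ks t =
      lin_ext (\<lambda>w. braid_word_op tetra_braiding ks (Poly_Mapping.single w 1)) t" for ks
    by (induction ks) (simp_all add: braid_word_op_def lin_ext_single_1 braid_at_def lin_ext_compose)
  then show "symmetrizer n t = lin_ext (\<lambda>w. symmetrizer n (Poly_Mapping.single w 1)) t"
    unfolding quantum_symmetrizer_def lin_ext_sum_fun by (simp add: section_op_def)
qed

interpretation symmetrizer: Vector_Spaces.linear scale scale "symmetrizer n" for n
  using linear_lin_ext[of "\<lambda>w. symmetrizer n (Poly_Mapping.single w 1)"]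
  by (simp only: symmetrizer_lin_ext[symmetric])

interpretation append_letter: Vector_Spaces.linear scale scale "append_letter a" for a
  unfolding append_letter_def by (rule linear_lin_ext)

lemma symmetrizer_compose: "symmetrizer n (lin_ext f t) = lin_ext (\<lambda>w. symmetrizer n (f w)) t"
  unfolding lin_ext_def by (simp only: symmetrizer.sum symmetrizer.scale)

lemma append_letter_compose: "append_letter a (lin_ext f t) = lin_ext (\<lambda>w. append_letter a (f w)) t"
  by (simp add: append_letter_def lin_ext_compose)

text \<open>
  \<open>skew a\<close> is the right skew derivation \<open>\<partial>\<^sub>a\<close> of the tensor algebra: it collects the terms in which
  the letter brought to the last place is \<open>x\<^sub>a\<close>. In \<open>skew_snoc\<close>, either the last letter itself is
  removed, or the extracted letter \<open>x\<^sub>a\<close> still has to cross \<open>x\<^sub>b\<close>, turning it into \<open>- x\<^bsub>a \<rhd> b\<^esub>\<close>.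
\<close>

definition skew :: "tetra \<Rightarrow> tetra list \<Rightarrow> (tetra list \<Rightarrow>\<^sub>0 'k::field)" where
  "skew a w = (\<Sum>k | k < length w \<and> w ! k = a.
     Poly_Mapping.single (pull_out k w) ((-1) ^ (length w - Suc k)))"

lemma skew_Nil [simp]: "skew a [] = 0"
  by (simp add: skew_def)

lemma skew_snoc:
  "skew a (w @ [b]) =
     (if a = b then Poly_Mapping.single w 1 else 0) - append_letter (a \<rhd> b) (skew a w)"
proof -
  have 1: "{k. k < length (w @ [b]) \<and> (w @ [b]) ! k = a} =
      {k. k < length w \<and> w ! k = a} \<union> (if a = b then {length w} else {})"
    by (auto simp: nth_append less_Suc_eq)
  have 2: "Poly_Mapping.single (pull_out k (w @ [b])) ((-1) ^ (length (w @ [b]) - Suc k)) =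
      - append_letter (a \<rhd> b) (Poly_Mapping.single (pull_out k w) ((-1) ^ (length w - Suc k)) :: _ \<Rightarrow>\<^sub>0 'a)"
    if "k < length w \<and> w ! k = a" for k
  proof -
    have "length w - k = Suc (length w - Suc k)" using that by auto
    then show ?thesis
      using that by (simp add: append_letter_def pull_out_def nth_append single_uminus)
  qed
  have 3: "Poly_Mapping.single (pull_out (length w) (w @ [b])) ((-1) ^ (length (w @ [b]) - Suc (length w))) =
      (Poly_Mapping.single w 1 :: _ \<Rightarrow>\<^sub>0 'a)"
    by (simp add: pull_out_def)
  show ?thesis
    unfolding skew_def 1
    by (subst sum.union_disjoint)
       (auto simp: 2 3 sum_negf append_letter_def lin_ext.sum simp del: length_append tetra_perm.simps)
qed

lemma keys_sum_obtain:
  assumes "w \<in> Poly_Mapping.keys (\<Sum>i\<in>I. f i)"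
  obtains i where "i \<in> I" "w \<in> Poly_Mapping.keys (f i)"
proof -
  have "\<exists>i\<in>I. Poly_Mapping.lookup (f i) w \<noteq> 0"
  proof (rule ccontr)
    assume "\<not> (\<exists>i\<in>I. Poly_Mapping.lookup (f i) w \<noteq> 0)"
    then have "Poly_Mapping.lookup (\<Sum>i\<in>I. f i) w = 0" by (simp add: lookup_sum)
    with assms show False by (simp add: in_keys_iff)
  qed
  with that show ?thesis by (auto simp: in_keys_iff)
qed

lemma lin_ext_tensor_power:
  assumes "t \<in> tensor_power m" "\<And>w. length w = m \<Longrightarrow> f w \<in> tensor_power n"
  shows "lin_ext f t \<in> tensor_power n"
proof -
  have "length v = n" if v: "v \<in> Poly_Mapping.keys (lin_ext f t)" for v
  proof -
    obtain w where w: "w \<in> Poly_Mapping.keys t" "v \<in> Poly_Mapping.keys (scale (Poly_Mapping.lookup t w) (f w))"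
      using v unfolding lin_ext_def by (rule keys_sum_obtain)
    then have "v \<in> Poly_Mapping.keys (f w)" by (auto simp: in_keys_iff)
    moreover have "f w \<in> tensor_power n"
      using w(1) assms(1) by (intro assms(2)) (simp add: tensor_power_def)
    ultimately show ?thesis by (simp add: tensor_power_def)
  qed
  then show ?thesis by (simp add: tensor_power_def)
qed

lemma skew_tensor_power:
  assumes "length w = Suc n"
  shows "skew a w \<in> tensor_power n"
proof -
  have "length v = n" if "v \<in> Poly_Mapping.keys (skew a w :: _ \<Rightarrow>\<^sub>0 'a)" for v
    using that unfolding skew_def
    by (rule keys_sum_obtain) (use assms in \<open>auto simp: length_pull_out\<close>)
  then show ?thesis by (simp add: tensor_power_def)
qed

lemma UNIV_tetra: "(UNIV :: tetra set) = {X0, X1, X2, X3}"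
  using tetra.exhaust by auto

lemma finite_UNIV_tetra [simp]: "finite (UNIV :: tetra set)"
  by (simp add: UNIV_tetra)

lemma symmetrizer_Suc:
  fixes t :: "tetra list \<Rightarrow>\<^sub>0 'k::field"
  assumes "t \<in> tensor_power (Suc n)"
  shows "symmetrizer (Suc n) t = (\<Sum>a\<in>UNIV. append_letter a (symmetrizer n (lin_ext (skew a) t)))"
proof -
  have "symmetrizer (Suc n) (Poly_Mapping.single w 1 :: _ \<Rightarrow>\<^sub>0 'k) =
      (\<Sum>a\<in>UNIV. append_letter a (symmetrizer n (skew a w)))" if "length w = Suc n" for w
  proof -
    have "{..n} = {k. k < length w}" using that by auto
    then have "symmetrizer (Suc n) (Poly_Mapping.single w 1 :: _ \<Rightarrow>\<^sub>0 'k) = (\<Sum>k | k < length w. append_letter (w ! k)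
        (symmetrizer n (Poly_Mapping.single (pull_out k w) ((-1) ^ (length w - Suc k)))))"
      using symmetrizer_single[OF that] that by simp
    also have "\<dots> = (\<Sum>a\<in>UNIV. \<Sum>k\<in>{k\<in>{k. k < length w}. w ! k = a}. append_letter (w ! k)
        (symmetrizer n (Poly_Mapping.single (pull_out k w) ((-1) ^ (length w - Suc k)))))"
      by (rule sum.group[symmetric]) auto
    also have "\<dots> = (\<Sum>a\<in>UNIV. append_letter a (symmetrizer n (skew a w)))"
      unfolding skew_def append_letter.sum symmetrizer.sum
      by (intro sum.cong) auto
    finally show ?thesis .
  qed
  then have "symmetrizer (Suc n) t = lin_ext (\<lambda>w. \<Sum>a\<in>UNIV. append_letter a (symmetrizer n (skew a w))) t"
    using assms by (subst symmetrizer_lin_ext, intro lin_ext_eqI) (auto simp: tensor_power_def)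
  also have "\<dots> = (\<Sum>a\<in>UNIV. append_letter a (symmetrizer n (lin_ext (skew a) t)))"
    by (simp add: lin_ext_sum_fun symmetrizer_compose append_letter_compose)
  finally show ?thesis .
qed

lemma lookup_append_letter:
  "Poly_Mapping.lookup (append_letter b t) (w @ [a]) = (if a = b then Poly_Mapping.lookup t w else 0)"
proof -
  have "Poly_Mapping.lookup (append_letter b t) (w @ [a]) =
      (\<Sum>v\<in>Poly_Mapping.keys t. if a = b \<and> v = w then Poly_Mapping.lookup t v else 0)"
    by (auto simp: append_letter_def lin_ext_def lookup_sum lookup_single when_def intro!: sum.cong)
  then show ?thesis by (auto simp: in_keys_iff)
qed

lemma symmetrizer_Suc_eq_0_iff:
  assumes "t \<in> tensor_power (Suc n)"
  shows "symmetrizer (Suc n) t = 0 \<longleftrightarrow> (\<forall>a. symmetrizer n (lin_ext (skew a) t) = 0)"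
proof
  assume 0: "symmetrizer (Suc n) t = 0"
  show "\<forall>a. symmetrizer n (lin_ext (skew a) t) = 0"
  proof
    fix a
    have "Poly_Mapping.lookup (symmetrizer n (lin_ext (skew a) t)) w = 0" for w
      using arg_cong[OF 0, of "\<lambda>s. Poly_Mapping.lookup s (w @ [a])"]
      by (simp add: symmetrizer_Suc[OF assms] lookup_sum lookup_append_letter)
    then show "symmetrizer n (lin_ext (skew a) t) = 0" by (intro poly_mapping_eqI) simp
  qed
next
  assume "\<forall>a. symmetrizer n (lin_ext (skew a) t) = 0"
  then show "symmetrizer (Suc n) t = 0"
    by (simp add: symmetrizer_Suc[OF assms] append_letter.zero)
qed

section \<open>A module of rank 72 with multiplications and skew derivations\<close>

text \<open>
  In this part the words are written from right to left, so that right multiplication by a letter is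
  \<open>Cons\<close>. A \<open>vec\<close> is an integral linear combination of words given as an association list; the
  operations cancel terms, so that the zero vector is the empty list and identities can be decided by
  evaluation.
\<close>

type_synonym vec = "(tetra list \<times> int) list"

fun add_term :: "tetra list \<Rightarrow> int \<Rightarrow> vec \<Rightarrow> vec" where
  "add_term u c [] = [(u, c)]"
| "add_term u c ((v, d) # l) =
     (if u = v then (if c + d = 0 then l else (v, c + d) # l) else (v, d) # add_term u c l)"

definition axpy :: "int \<Rightarrow> vec \<Rightarrow> vec \<Rightarrow> vec" where
  "axpy a l m = foldr (\<lambda>(u, c). add_term u (a * c)) l m"

definition extend :: "(tetra list \<Rightarrow> vec) \<Rightarrow> vec \<Rightarrow> vec" where
  "extend f l = foldr (\<lambda>(u, c). axpy c (f u)) l []"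

text \<open>
  The Groebner basis of the defining ideal for the degree lexicographic order: in the usual reading,
  \<open>x\<^sub>i\<^sup>2 = 0\<close>, the four relations \<open>x\<^sub>2x\<^sub>0 = - x\<^sub>0x\<^sub>1 - x\<^sub>1x\<^sub>2\<close> etc. given by the orbits of the braiding on
  the pairs of different letters, their consequences \<open>x\<^sub>1x\<^sub>0x\<^sub>1 = x\<^sub>0x\<^sub>1x\<^sub>0\<close> and
  \<open>x\<^sub>2x\<^sub>1x\<^sub>2 = x\<^sub>1x\<^sub>2x\<^sub>1\<close>, and one relation in degree 6.
\<close>

definition rewrite_rules :: "(tetra list \<times> vec) list" where
  "rewrite_rules =
    [([X0, X0], []), ([X1, X1], []), ([X2, X2], []), ([X3, X3], []),
     ([X0, X2], [([X1, X0], -1), ([X2, X1], -1)]),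
     ([X0, X3], [([X2, X0], -1), ([X3, X2], -1)]),
     ([X1, X3], [([X3, X0], -1), ([X0, X1], -1)]),
     ([X2, X3], [([X3, X1], -1), ([X1, X2], -1)]),
     ([X1, X0, X1], [([X0, X1, X0], 1)]),
     ([X2, X1, X2], [([X1, X2, X1], 1)]),
     ([X0, X1, X2, X0, X1, X2],
       [([X1, X2, X0, X1, X2, X0], -1), ([X2, X0, X1, X2, X0, X1], -1)])]"

fun strip :: "'a list \<Rightarrow> 'a list \<Rightarrow> 'a list option" where
  "strip [] u = Some u"
| "strip (a # l) [] = None"
| "strip (a # l) (b # u) = (if a = b then strip l u else None)"

fun first_match :: "(tetra list \<times> vec) list \<Rightarrow> tetra list \<Rightarrow> (vec \<times> tetra list) option" where
  "first_match [] u = None"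
| "first_match ((l, r) # rs) u = (case strip l u of Some p \<Rightarrow> Some (r, p) | None \<Rightarrow> first_match rs u)"

text \<open>
  Multiplication of a normal word by a letter on the right, followed by reduction to normal words.
  The first argument bounds the nesting of rewriting steps; a nesting of 6 occurs.
\<close>

primrec rmul_depth :: "nat \<Rightarrow> tetra \<Rightarrow> tetra list \<Rightarrow> vec" where
  "rmul_depth 0 b u = []"
| "rmul_depth (Suc n) b u =
     (case first_match rewrite_rules (b # u) of
        None \<Rightarrow> [(b # u, 1)]
      | Some (r, p) \<Rightarrow> extend (\<lambda>v. foldr (\<lambda>a. extend (rmul_depth n a)) v [(p, 1)]) r)"

definition rmul :: "tetra \<Rightarrow> tetra list \<Rightarrow> vec" where
  "rmul = rmul_depth 6"

text \<open>
  The skew derivations on normal words follow the recursion \<open>skew_snoc\<close>, with the multiplication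
  carried out modulo the relations.
\<close>

primrec der :: "tetra \<Rightarrow> tetra list \<Rightarrow> vec" where
  "der a [] = []"
| "der a (b # u) = axpy (-1) (extend (rmul (tetra_perm a b)) (der a u)) (if a = b then [(u, 1)] else [])"

text \<open>
  In the usual reading these are the products of a prefix of \<open>x\<^sub>0\<close>, a prefix of \<open>x\<^sub>1x\<^sub>0\<close>, a prefix of
  \<open>x\<^sub>2x\<^sub>1x\<^sub>0x\<^sub>2x\<^sub>1\<close> and a prefix of \<open>x\<^sub>3\<close>, which gives the Hilbert series
  \<open>(1 + t) (1 + t + t\<^sup>2) (1 + t + \<dots> + t\<^sup>5) (1 + t)\<close>.
\<close>

definition normal_words :: "tetra list list" where
  "normal_words = [s @ r @ q @ p.
     s \<leftarrow> [[], [X3]],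
     r \<leftarrow> [[], [X2], [X1, X2], [X0, X1, X2], [X2, X0, X1, X2], [X1, X2, X0, X1, X2]],
     q \<leftarrow> [[], [X1], [X0, X1]], p \<leftarrow> [[], [X0]]]"

text \<open>
  For a normal word \<open>w\<close> other than the empty one, \<open>detector w\<close> lists triples \<open>(c, a, v)\<close> such that the
  functional \<open>t \<mapsto> \<Sum> c \<cdot> (coefficient of v in \<partial>\<^sub>a t)\<close> is a nonzero multiple of the coefficient of \<open>w\<close> in
  \<open>t\<close>, for \<open>t\<close> of the same degree as \<open>w\<close>. For words that end in \<open>x\<^sub>3\<close> removing this letter does it,
  since \<open>\<partial>\<^sub>3\<close> kills all words in \<open>x\<^sub>0, x\<^sub>1, x\<^sub>2\<close>. The other functionals come from elimination in the
  matrix of \<open>(\<partial>\<^sub>0, \<partial>\<^sub>1, \<partial>\<^sub>2)\<close>; the multiples that occur are \<open>1\<close>, \<open>-1\<close>, \<open>2\<close> and \<open>-2\<close>.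
\<close>

definition certificate :: "(tetra list \<times> (int \<times> tetra \<times> tetra list) list) list" where
  "certificate = [
   ([X0], [(1, X0, [])]),
   ([X1], [(1, X1, [])]),
   ([X2], [(1, X2, [])]),
   ([X1, X0], [(1, X0, [X2])]),
   ([X2, X0], [(1, X0, [X3])]),
   ([X0, X1], [(1, X1, [X3])]),
   ([X2, X1], [(1, X2, [X1])]),
   ([X1, X2], [(1, X2, [X3])]),
   ([X0, X1, X0], [(1, X0, [X2, X1])]),
   ([X2, X1, X0], [(1, X0, [X3, X2])]),
   ([X1, X2, X0], [(1, X0, [X3, X1]), (-1, X1, [X3, X2]), (1, X2, [X3, X0])]),
   ([X2, X0, X1], [(1, X0, [X3, X1]), (1, X1, [X3, X2]), (-1, X2, [X3, X0])]),
   ([X1, X2, X1], [(1, X1, [X1, X0])]),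
   ([X0, X1, X2], [(1, X0, [X3, X1]), (-1, X1, [X3, X2]), (-1, X2, [X3, X0])]),
   ([X2, X0, X1, X0], [(1, X0, [X1, X2, X0]), (1, X1, [X3, X2, X0])]),
   ([X1, X2, X1, X0], [(1, X0, [X3, X1, X2]), (-1, X2, [X3, X1, X0])]),
   ([X0, X1, X2, X0], [(1, X0, [X1, X2, X0])]),
   ([X1, X2, X0, X1], [(1, X1, [X2, X0, X1])]),
   ([X0, X1, X2, X1], [(1, X0, [X1, X2, X1]), (1, X1, [X1, X2, X0])]),
   ([X2, X0, X1, X2], [(1, X2, [X1, X2, X0])]),
   ([X1, X2, X0, X1, X0], [(1, X1, [X2, X0, X1, X0])]),
   ([X0, X1, X2, X1, X0], [(1, X0, [X1, X2, X1, X0])]),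
   ([X2, X0, X1, X2, X0], [(1, X0, [X3, X1, X2, X0])]),
   ([X0, X1, X2, X0, X1], [(1, X1, [X3, X2, X0, X1])]),
   ([X2, X0, X1, X2, X1], [(1, X2, [X1, X2, X0, X1])]),
   ([X1, X2, X0, X1, X2], [(1, X2, [X3, X1, X2, X0])]),
   ([X0, X1, X2, X0, X1, X0], [(1, X0, [X1, X2, X0, X1, X0])]),
   ([X2, X0, X1, X2, X1, X0], [(1, X0, [X3, X1, X2, X1, X0])]),
   ([X1, X2, X0, X1, X2, X0], [(1, X2, [X3, X0, X1, X2, X0])]),
   ([X2, X0, X1, X2, X0, X1], [(1, X1, [X3, X2, X0, X1, X2])]),
   ([X1, X2, X0, X1, X2, X1], [(1, X1, [X0, X1, X2, X1, X0])]),
   ([X2, X0, X1, X2, X0, X1, X0], [(1, X0, [X3, X1, X2, X0, X1, X0])]),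
   ([X1, X2, X0, X1, X2, X1, X0], [(1, X0, [X3, X1, X2, X0, X1, X2])]),
   ([X1, X2, X0, X1, X2, X0, X1], [(1, X1, [X3, X2, X0, X1, X2, X1])]),
   ([X1, X2, X0, X1, X2, X0, X1, X0], [(1, X0, [X3, X1, X2, X0, X1, X2, X1])])]"

definition detector :: "tetra list \<Rightarrow> (int \<times> tetra \<times> tetra list) list" where
  "detector w =
     (if w \<noteq> [] \<and> hd w = X3 then [(1, X3, tl w)]
      else case map_of certificate w of Some d \<Rightarrow> d | None \<Rightarrow> [])"

definition coordinate :: "tetra list \<Rightarrow> vec \<Rightarrow> int" where
  "coordinate v l = (\<Sum>(u, c)\<leftarrow>l. if u = v then c else 0)"

definition pairing :: "tetra list \<Rightarrow> tetra list \<Rightarrow> int" where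
  "pairing w u = (\<Sum>(c, a, v)\<leftarrow>detector w. c * coordinate v (der a u))"

definition letters :: "tetra list" where
  "letters = [X0, X1, X2, X3]"

lemma set_letters [simp]: "a \<in> set letters"
  by (cases a) (simp_all add: letters_def)

text \<open>
  The evaluation below uses the table of the rack instead of compositions of transpositions.
\<close>

lemmas [code] = tetra_perm_simps

lemma distinct_normal_words: "distinct normal_words"
  by code_simp

lemma length_filter_normal_words:
  "map (\<lambda>n. length (filter (\<lambda>w. length w = n) normal_words)) [0..<10] = [1, 4, 8, 11, 12, 12, 11, 8, 4, 1]"
  by code_simp

lemma length_normal_words: "length normal_words = 72"
  by code_simp

lemma check_closed:
  "list_all (\<lambda>u. list_all (\<lambda>b. list_all
     (\<lambda>(v, c). v \<in> set normal_words \<and> length v = Suc (length u)) (rmul b u)) letters) normal_words"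
  by code_simp

lemma check_tails:
  "list_all (\<lambda>w. w = [] \<or> tl w \<in> set normal_words \<and> rmul (hd w) (tl w) = [(w, 1)]) normal_words"
  by code_simp

text \<open>
  The crucial identity \<open>\<partial>\<^sub>a (u x\<^sub>b) = \<delta>\<^bsub>ab\<^esub> u - \<partial>\<^sub>a(u) x\<^bsub>a \<rhd> b\<^esub>\<close>. When \<open>u x\<^sub>b\<close> is a normal word it is the
  recursion for \<open>der\<close>; in all other cases it says that \<open>\<partial>\<^sub>a\<close> is compatible with the relations.
\<close>

lemma check_skew_leibniz:
  "list_all (\<lambda>u. list_all (\<lambda>b. let r = rmul b u in r = [(b # u, 1)] \<or>
     list_all (\<lambda>a. axpy (-1) (extend (der a) r)
       (axpy (-1) (extend (rmul (tetra_perm a b)) (der a u)) (if a = b then [(u, 1)] else [])) = [])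
     letters) letters) normal_words"
  by code_simp

lemma check_pairing:
  "list_all (\<lambda>w. w = [] \<or> list_all (\<lambda>u. length u = length w \<longrightarrow> (pairing w u = 0) = (u \<noteq> w)) normal_words)
     normal_words"
  by code_simp

definition realize :: "vec \<Rightarrow> (tetra list \<Rightarrow>\<^sub>0 'k::field)" where
  "realize l = (\<Sum>(u, c)\<leftarrow>l. Poly_Mapping.single u (of_int c))"

lemma realize_simps [simp]:
  "realize [] = 0"
  "realize ((u, c) # l) = Poly_Mapping.single u (of_int c) + realize l"
  by (simp_all add: realize_def)

lemma realize_add_term: "realize (add_term u c l) = Poly_Mapping.single u (of_int c) + realize l"
proof (induction u c l rule: add_term.induct)
  case (2 u c v d l)
  have "c + d = 0 \<Longrightarrow> (of_int c + of_int d :: 'a) = 0" by (simp flip: of_int_add)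
  then show ?case using 2
    by (auto simp: single_add[symmetric] add.assoc[symmetric] add.left_commute)
qed simp

lemma realize_axpy: "realize (axpy a l m) = scale (of_int a) (realize l) + realize m"
  by (induction l) (auto simp: axpy_def realize_add_term free_space.scale_right_distrib add.assoc)

lemma realize_extend: "realize (extend f l) = lin_ext (\<lambda>u. realize (f u)) (realize l)"
  by (induction l) (auto simp: extend_def realize_axpy lin_ext.zero lin_ext.add)

definition times_letter :: "tetra \<Rightarrow> (tetra list \<Rightarrow>\<^sub>0 'k::field) \<Rightarrow> (tetra list \<Rightarrow>\<^sub>0 'k)" where
  "times_letter b = lin_ext (\<lambda>u. realize (rmul b u))"

definition derive_by :: "tetra \<Rightarrow> (tetra list \<Rightarrow>\<^sub>0 'k::field) \<Rightarrow> (tetra list \<Rightarrow>\<^sub>0 'k)" where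
  "derive_by a = lin_ext (\<lambda>u. realize (der a u))"

interpretation times_letter: Vector_Spaces.linear scale scale "times_letter b" for b
  unfolding times_letter_def by (rule linear_lin_ext)

interpretation derive_by: Vector_Spaces.linear scale scale "derive_by a" for a
  unfolding derive_by_def by (rule linear_lin_ext)

definition normal_space :: "(tetra list \<Rightarrow>\<^sub>0 'k::field) set" where
  "normal_space = {t. Poly_Mapping.keys t \<subseteq> set normal_words}"

lemma rmul_closed:
  assumes "u \<in> set normal_words" "(v, c) \<in> set (rmul b u)"
  shows "v \<in> set normal_words" "length v = Suc (length u)"
  using check_closed assms set_letters[of b] unfolding list_all_iff by fastforce+

lemma keys_realize: "v \<in> Poly_Mapping.keys (realize l) \<Longrightarrow> v \<in> fst ` set l"
proof (induction l)
  case (Cons p l)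
  then show ?case
    by (cases p) (auto dest!: subsetD[OF keys_add] split: if_splits)
qed simp

lemma times_letter_closed:
  assumes "t \<in> normal_space"
  shows "times_letter b t \<in> normal_space"
    "t \<in> tensor_power n \<Longrightarrow> times_letter b t \<in> tensor_power (Suc n)"
proof -
  have "\<exists>u c. u \<in> Poly_Mapping.keys t \<and> (v, c) \<in> set (rmul b u)"
    if v: "v \<in> Poly_Mapping.keys (times_letter b t)" for v
  proof -
    obtain u where u: "u \<in> Poly_Mapping.keys t"
        "v \<in> Poly_Mapping.keys (scale (Poly_Mapping.lookup t u) (realize (rmul b u)))"
      using v unfolding times_letter_def lin_ext_def by (rule keys_sum_obtain)
    then have "v \<in> Poly_Mapping.keys (realize (rmul b u) :: _ \<Rightarrow>\<^sub>0 'a)" by (auto simp: in_keys_iff)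
    then show ?thesis using keys_realize u(1) by force
  qed
  note * = this
  show "times_letter b t \<in> normal_space"
    using * rmul_closed(1) assms unfolding normal_space_def by blast
  show "times_letter b t \<in> tensor_power (Suc n)" if "t \<in> tensor_power n"
    using * rmul_closed(2) assms that unfolding normal_space_def tensor_power_def by fast
qed

lemma derive_by_times_letter_single:
  assumes u: "u \<in> set normal_words"
  shows "derive_by a (times_letter b (Poly_Mapping.single u 1)) =
    (if a = b then Poly_Mapping.single u 1 else 0)
      - times_letter (a \<rhd> b) (derive_by a (Poly_Mapping.single u (1 :: 'k::field)))"
proof -
  let ?e = "if a = b then [(u, 1)] else []"
  have e: "(realize ?e :: _ \<Rightarrow>\<^sub>0 'k) = (if a = b then Poly_Mapping.single u 1 else 0)" by simp
  consider "rmul b u = [(b # u, 1)]"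
    | "axpy (-1) (extend (der a) (rmul b u)) (axpy (-1) (extend (rmul (a \<rhd> b)) (der a u)) ?e) = []"
    using check_skew_leibniz u set_letters[of a] set_letters[of b]
    unfolding list_all_iff Let_def by blast
  then show ?thesis
  proof cases
    case 1
    then show ?thesis
      by (simp add: times_letter_def derive_by_def realize_axpy realize_extend del: tetra_perm.simps)
  next
    case 2
    from arg_cong[OF this, of "realize :: _ \<Rightarrow> _ \<Rightarrow>\<^sub>0 'k"] show ?thesis
      by (simp add: times_letter_def derive_by_def realize_axpy realize_extend e algebra_simps
          del: tetra_perm.simps)
  qed
qed

lemma derive_by_times_letter:
  assumes "t \<in> normal_space"
  shows "derive_by a (times_letter b t) = (if a = b then t else 0) - times_letter (a \<rhd> b) (derive_by a t)"
proof -
  have "Vector_Spaces.linear scale scale (\<lambda>t. derive_by a (times_letter b t) :: _ \<Rightarrow>\<^sub>0 'a)"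
    by (unfold_locales) (simp_all add: times_letter.add derive_by.add times_letter.scale derive_by.scale)
  moreover have "Vector_Spaces.linear scale scale
      (\<lambda>t. (if a = b then t else 0) - times_letter (a \<rhd> b) (derive_by a t) :: _ \<Rightarrow>\<^sub>0 'a)"
    by (unfold_locales) (simp_all add: times_letter.add derive_by.add times_letter.scale derive_by.scale
        free_space.scale_right_diff_distrib)
  ultimately show ?thesis
    by (rule linear_eqI)
      (rule derive_by_times_letter_single, use assms in \<open>auto simp: normal_space_def\<close>)
qed

section \<open>The map from the tensor algebra\<close>

definition word_image :: "tetra list \<Rightarrow> (tetra list \<Rightarrow>\<^sub>0 'k::field)" where
  "word_image w = foldl (\<lambda>t b. times_letter b t) (Poly_Mapping.single [] 1) w"

definition evaluate :: "(tetra list \<Rightarrow>\<^sub>0 'k::field) \<Rightarrow> (tetra list \<Rightarrow>\<^sub>0 'k)" where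
  "evaluate = lin_ext word_image"

lemma word_image_simps [simp]:
  "word_image [] = Poly_Mapping.single [] 1"
  "word_image (w @ [b]) = times_letter b (word_image w)"
  by (simp_all add: word_image_def)

interpretation evaluate: Vector_Spaces.linear scale scale evaluate
  unfolding evaluate_def by (rule linear_lin_ext)

lemma evaluate_single [simp]: "evaluate (Poly_Mapping.single w 1) = word_image w"
  by (simp add: evaluate_def)

lemma evaluate_append_letter: "evaluate (append_letter b t) = times_letter b (evaluate t)"
  by (simp add: evaluate_def append_letter_def lin_ext_compose)
    (simp add: times_letter_def lin_ext_compose)

lemma word_image_closed:
  "(word_image w :: _ \<Rightarrow>\<^sub>0 'k::field) \<in> normal_space"
  "(word_image w :: _ \<Rightarrow>\<^sub>0 'k) \<in> tensor_power (length w)"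
proof (induction w rule: rev_induct)
  case Nil
  have "[] \<in> set normal_words" by (simp add: normal_words_def)
  case 1 show ?case using \<open>[] \<in> set normal_words\<close> by (simp add: normal_space_def)
  case 2 show ?case by (simp add: tensor_power_def)
next
  case (snoc b w)
  case 1 show ?case using times_letter_closed(1)[OF snoc(1)] by simp
  case 2 show ?case using times_letter_closed(2)[OF snoc] by simp
qed

lemma evaluate_skew: "evaluate (skew a w) = derive_by a (word_image w :: _ \<Rightarrow>\<^sub>0 'k::field)"
proof (induction w rule: rev_induct)
  case Nil
  show ?case by (simp add: evaluate.zero derive_by_def)
next
  case (snoc b w)
  have "evaluate (skew a (w @ [b])) = (if a = b then word_image w else 0 :: _ \<Rightarrow>\<^sub>0 'k)
      - times_letter (a \<rhd> b) (derive_by a (word_image w))"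
    by (simp add: skew_snoc evaluate.diff evaluate_append_letter snoc.IH evaluate.zero
        del: tetra_perm.simps)
  also have "\<dots> = derive_by a (word_image (w @ [b]))"
    by (simp add: derive_by_times_letter[OF word_image_closed(1)] del: tetra_perm.simps)
  finally show ?case .
qed

lemma evaluate_lin_ext_skew: "evaluate (lin_ext (skew a) t) = derive_by a (evaluate t)"
  by (simp add: evaluate_def derive_by_def lin_ext_compose
      evaluate_skew[unfolded evaluate_def derive_by_def])

lemma evaluate_closed:
  "evaluate t \<in> normal_space"
  "t \<in> tensor_power n \<Longrightarrow> evaluate t \<in> tensor_power n"
proof -
  have "v \<in> set normal_words" if v: "v \<in> Poly_Mapping.keys (evaluate t)" for v
  proof -
    obtain w where "v \<in> Poly_Mapping.keys (scale (Poly_Mapping.lookup t w) (word_image w))"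
      using v unfolding evaluate_def lin_ext_def by (rule keys_sum_obtain)
    then have "v \<in> Poly_Mapping.keys (word_image w :: _ \<Rightarrow>\<^sub>0 'a)" by (auto simp: in_keys_iff)
    then show ?thesis using word_image_closed(1) by (auto simp: normal_space_def)
  qed
  then show "evaluate t \<in> normal_space" by (auto simp: normal_space_def)
  show "evaluate t \<in> tensor_power n" if "t \<in> tensor_power n"
    unfolding evaluate_def using that word_image_closed(2) by (intro lin_ext_tensor_power) auto
qed

lemma lookup_realize: "Poly_Mapping.lookup (realize l) v = of_int (coordinate v l)"
  by (induction l) (auto simp: coordinate_def lookup_add lookup_single when_def)

text \<open>
  No element of positive degree is killed by all skew derivations: the functionals of \<open>detector\<close>
  recover its coefficients up to the factors \<open>1, -1, 2, -2\<close>, which are invertible in characteristic 0.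
\<close>

lemma joint_kernel_trivial:
  fixes t :: "tetra list \<Rightarrow>\<^sub>0 'k::field_char_0"
  assumes t: "t \<in> normal_space" "t \<in> tensor_power (Suc n)" and 0: "\<And>a. derive_by a t = 0"
  shows "t = 0"
proof (rule poly_mapping_eqI)
  fix w
  show "Poly_Mapping.lookup t w = Poly_Mapping.lookup 0 w"
  proof (cases "w \<in> Poly_Mapping.keys t")
    case True
    have pairing: "pairing w u = 0 \<longleftrightarrow> u \<noteq> w" if "u \<in> Poly_Mapping.keys t" for u
    proof -
      have "w \<in> set normal_words" "u \<in> set normal_words" "length w = Suc n" "length u = Suc n"
        using t True that by (auto simp: normal_space_def tensor_power_def)
      then show ?thesis using check_pairing unfolding list_all_iff by fastforce
    qed
    have "(\<Sum>u\<in>Poly_Mapping.keys t. Poly_Mapping.lookup t u *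
          of_int (\<Sum>(c, a, v)\<leftarrow>d. c * coordinate v (der a u))) =
        (\<Sum>(c, a, v)\<leftarrow>d. of_int c * Poly_Mapping.lookup (derive_by a t) v)" for d
      by (induction d)
        (auto simp: derive_by_def lin_ext_def lookup_sum lookup_realize sum_distrib_left sum.distrib
          distrib_left mult.left_commute)
    note expand = this
    have zero: "(\<Sum>(c, a, v)\<leftarrow>d. of_int c * Poly_Mapping.lookup (derive_by a t) v) = 0" for d
      by (induction d) (auto simp: 0)
    from expand[of "detector w"]
    have "(\<Sum>u\<in>Poly_Mapping.keys t. Poly_Mapping.lookup t u * of_int (pairing w u)) =
        (\<Sum>(c, a, v)\<leftarrow>detector w. of_int c * Poly_Mapping.lookup (derive_by a t) v)"
      by (simp only: pairing_def)
    also have "\<dots> = 0" by (rule zero)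
    also have "(\<Sum>u\<in>Poly_Mapping.keys t. Poly_Mapping.lookup t u * of_int (pairing w u)) =
        (\<Sum>u\<in>Poly_Mapping.keys t. if u = w then Poly_Mapping.lookup t w * of_int (pairing w w) else 0)"
      using pairing by (intro sum.cong) auto
    also have "\<dots> = Poly_Mapping.lookup t w * of_int (pairing w w)" using True by simp
    finally show ?thesis using pairing[OF True] by simp
  qed (simp add: in_keys_iff)
qed

lemma word_image_rev_normal: "u \<in> set normal_words \<Longrightarrow> word_image (rev u) = Poly_Mapping.single u 1"
proof (induction u)
  case Nil
  show ?case by simp
next
  case (Cons b u)
  then have "u \<in> set normal_words" "rmul b u = [(b # u, 1)]"
    using check_tails unfolding list_all_iff by fastforce+
  then show ?case using Cons.IH by (simp add: times_letter_def)
qed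

lemma evaluate_rev_normal:
  assumes "t \<in> normal_space"
  shows "evaluate (lin_ext (\<lambda>u. Poly_Mapping.single (rev u) 1) t) = t"
proof -
  have "evaluate (lin_ext (\<lambda>u. Poly_Mapping.single (rev u) 1) t) = lin_ext (\<lambda>u. Poly_Mapping.single u 1) t"
    unfolding evaluate_def lin_ext_compose
    by (rule lin_ext_eqI) (use assms in \<open>auto simp: normal_space_def word_image_rev_normal\<close>)
  then show ?thesis by (simp add: lin_ext_single_1)
qed

lemma symmetrizer_0: "t \<in> tensor_power 0 \<Longrightarrow> symmetrizer 0 t = t"
proof -
  assume t: "t \<in> tensor_power 0"
  have e: "expression_of 0 id []" by (simp add: expression_of_def perm_of_word_def)
  have "symmetrizer 0 (Poly_Mapping.single [] 1) = Poly_Mapping.single [] 1"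
    by (simp add: quantum_symmetrizer_def section_op_single[OF e] inversions_def)
  then have "lin_ext (\<lambda>w. symmetrizer 0 (Poly_Mapping.single w 1)) t = lin_ext (\<lambda>w. Poly_Mapping.single w 1) t"
    using t by (intro lin_ext_eqI) (auto simp: tensor_power_def)
  then show ?thesis by (simp add: symmetrizer_lin_ext[symmetric] lin_ext_single_1)
qed

text \<open>
  Both kernels satisfy the same recursion: in positive degree an element lies in the kernel if and
  only if all its skew derivatives do. For the symmetrizer this is its factorization, for \<open>evaluate\<close>
  it combines the compatibility with the skew derivations and the triviality of their joint kernel.
\<close>

lemma symmetrizer_eq_0_iff_evaluate:
  fixes t :: "tetra list \<Rightarrow>\<^sub>0 'k::field_char_0"
  assumes "t \<in> tensor_power n"
  shows "symmetrizer n t = 0 \<longleftrightarrow> evaluate t = 0"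
  using assms
proof (induction n arbitrary: t)
  case 0
  have "evaluate t = lin_ext (\<lambda>w. Poly_Mapping.single w 1) t"
    unfolding evaluate_def
    by (rule lin_ext_eqI) (use 0 in \<open>auto simp: tensor_power_def\<close>)
  then show ?case using symmetrizer_0[OF 0] by (simp add: lin_ext_single_1)
next
  case (Suc n)
  have "lin_ext (skew a) t \<in> tensor_power n" for a
    using Suc.prems skew_tensor_power by (rule lin_ext_tensor_power)
  then have "symmetrizer (Suc n) t = 0 \<longleftrightarrow> (\<forall>a. derive_by a (evaluate t) = 0)"
    using Suc.IH by (simp add: symmetrizer_Suc_eq_0_iff[OF Suc.prems] evaluate_lin_ext_skew)
  also have "\<dots> \<longleftrightarrow> evaluate t = 0"
    using joint_kernel_trivial[OF evaluate_closed(1) evaluate_closed(2)[OF Suc.prems]] derive_by.zero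
    by auto
  finally show ?case .
qed

section \<open>Dimensions\<close>

text \<open>
  Both images are the quotient of \<open>U\<close> by the common kernel. The isomorphism between them is \<open>g\<close> after
  a linear section of \<open>f\<close> on \<open>f ` U\<close>.
\<close>

lemma dim_image_eq_if_same_kernel:
  fixes f :: "('b \<Rightarrow>\<^sub>0 'k::field) \<Rightarrow> ('d \<Rightarrow>\<^sub>0 'k)" and g :: "('b \<Rightarrow>\<^sub>0 'k) \<Rightarrow> ('e \<Rightarrow>\<^sub>0 'k)"
  assumes f: "Vector_Spaces.linear scale scale f" and g: "Vector_Spaces.linear scale scale g"
    and U: "free_space.subspace U" and ker: "\<And>u. u \<in> U \<Longrightarrow> f u = 0 \<longleftrightarrow> g u = 0"
  shows "free_space.dim (f ` U) = free_space.dim (g ` U)"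
proof -
  interpret f: Vector_Spaces.linear scale scale f by fact
  interpret g: Vector_Spaces.linear scale scale g by fact
  interpret db: vector_space_pair "scale :: 'k \<Rightarrow> ('d \<Rightarrow>\<^sub>0 'k) \<Rightarrow> _" "scale :: 'k \<Rightarrow> ('b \<Rightarrow>\<^sub>0 'k) \<Rightarrow> _" ..
  interpret de: vector_space_pair "scale :: 'k \<Rightarrow> ('d \<Rightarrow>\<^sub>0 'k) \<Rightarrow> _" "scale :: 'k \<Rightarrow> ('e \<Rightarrow>\<^sub>0 'k) \<Rightarrow> _" ..
  interpret bd: vector_space_pair "scale :: 'k \<Rightarrow> ('b \<Rightarrow>\<^sub>0 'k) \<Rightarrow> _" "scale :: 'k \<Rightarrow> ('d \<Rightarrow>\<^sub>0 'k) \<Rightarrow> _" ..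
  have fU: "free_space.subspace (f ` U)" using f U by (rule bd.linear_subspace_image)
  obtain B where B: "B \<subseteq> f ` U" "free_space.independent B" "f ` U \<subseteq> free_space.span B"
      "card B = free_space.dim (f ` U)"
    by (rule free_space.basis_exists)
  have span: "free_space.span B = f ` U" using B(1,3) fU by (rule free_space.span_subspace)
  obtain s where s: "\<And>b. b \<in> B \<Longrightarrow> s b \<in> U \<and> f (s b) = b"
  proof
    show "inv_into U f b \<in> U \<and> f (inv_into U f b) = b" if "b \<in> B" for b
      using B(1) that by (auto intro: inv_into_into f_inv_into_f)
  qed
  define r where "r = db.construct B s"
  have r: "Vector_Spaces.linear scale scale r"
    unfolding r_def using B(2) by (rule db.linear_construct)
  interpret r: Vector_Spaces.linear scale scale r by fact
  have rb: "r b = s b" if "b \<in> B" for b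
    unfolding r_def using B(2) that by (rule db.construct_basis)
  have rU: "r y \<in> U \<and> f (r y) = y" if "y \<in> f ` U" for y
  proof -
    have "y \<in> free_space.span B" using that span by simp
    then show ?thesis
    proof (induction rule: free_space.span_induct_alt)
      case base
      show ?case using U by (simp add: r.zero f.zero free_space.subspace_0)
    next
      case (step c b y)
      then show ?case using s[of b] U
        by (simp add: r.add r.scale f.add f.scale rb free_space.subspace_add free_space.subspace_scale)
    qed
  qed
  define h where "h = g \<circ> r"
  have h: "Vector_Spaces.linear scale scale h"
    unfolding h_def using r g by (rule Vector_Spaces.linear_compose)
  interpret h: Vector_Spaces.linear scale scale h by fact
  have inj: "inj_on h (free_space.span B)"
  proof -
    have "y = 0" if "y \<in> f ` U" "h y = 0" for y
      using rU[OF that(1)] ker[of "r y"] that(2) by (simp add: h_def)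
    then show ?thesis
      using de.linear_inj_on_iff_eq_0[OF h free_space.subspace_span[of B]] by (auto simp: span)
  qed
  have "h ` (f ` U) = g ` U"
  proof (intro equalityI subsetI)
    fix z assume "z \<in> g ` U"
    then obtain u where u: "u \<in> U" "z = g u" by blast
    have "f (u - r (f u)) = 0" using rU u(1) by (simp add: f.diff)
    moreover have "u - r (f u) \<in> U" using rU u(1) U by (simp add: free_space.subspace_diff)
    ultimately have "g u = h (f u)" using ker by (simp add: g.diff h_def)
    then show "z \<in> h ` f ` U" using u by blast
  qed (auto simp: h_def rU)
  then have "g ` U = free_space.span (h ` B)"
    using de.linear_span_image[OF h, of B] span by simp
  moreover have "free_space.independent (h ` B)"
    using de.linear_independent_injective_image[OF h B(2) inj] .
  ultimately have "free_space.dim (g ` U) = card (h ` B)"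
    by (simp add: free_space.dim_span free_space.dim_eq_card_independent)
  also have "card (h ` B) = card B"
    by (rule card_image) (rule inj_on_subset[OF inj free_space.span_superset])
  finally show ?thesis using B(4) by simp
qed

lemma dim_coordinate_subspace:
  assumes "finite A"
  shows "free_space.dim {t :: 'b \<Rightarrow>\<^sub>0 'k::field. Poly_Mapping.keys t \<subseteq> A} = card A"
proof -
  let ?e = "\<lambda>a. Poly_Mapping.single a (1 :: 'k)"
  have inj: "inj_on ?e A"
    by (rule inj_onI) (metis lookup_single_eq lookup_single_not_eq zero_neq_one)
  have sub: "free_space.subspace {t :: 'b \<Rightarrow>\<^sub>0 'k. Poly_Mapping.keys t \<subseteq> A}"
    by (rule free_space.subspaceI) (auto dest!: subsetD[OF keys_add] simp: in_keys_iff)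
  have "free_space.span (?e ` A) = {t. Poly_Mapping.keys t \<subseteq> A}"
  proof (rule free_space.span_subspace)
    show "{t. Poly_Mapping.keys t \<subseteq> A} \<subseteq> free_space.span (?e ` A)"
    proof clarify
      fix t :: "'b \<Rightarrow>\<^sub>0 'k" assume "Poly_Mapping.keys t \<subseteq> A"
      then have "(\<Sum>b\<in>Poly_Mapping.keys t. scale (Poly_Mapping.lookup t b) (?e b)) \<in> free_space.span (?e ` A)"
        by (intro free_space.span_sum free_space.span_scale free_space.span_base) auto
      then show "t \<in> free_space.span (?e ` A)" by (simp only: poly_mapping_expand[symmetric])
    qed
  qed (use sub in auto)
  moreover have "free_space.independent (?e ` A)"
  proof (rule free_space.independent_if_scalars_zero)
    fix f x assume s: "(\<Sum>x\<in>?e ` A. scale (f x) x) = 0" and x: "x \<in> ?e ` A"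
    then obtain a where a: "a \<in> A" "x = ?e a" by blast
    have "(\<Sum>b\<in>A. f (?e b) * Poly_Mapping.lookup (?e b) a) = 0"
      using arg_cong[OF s, of "\<lambda>t. Poly_Mapping.lookup t a"]
      by (simp add: sum.reindex[OF inj] lookup_sum del: scale_single)
    moreover have "f (?e b) * Poly_Mapping.lookup (?e b) a = (if b = a then f x else 0)" for b
      using a by (simp add: lookup_single when_def)
    ultimately show "f x = 0" using a assms by simp
  qed (use assms in simp)
  ultimately have "free_space.dim {t :: 'b \<Rightarrow>\<^sub>0 'k. Poly_Mapping.keys t \<subseteq> A} = card (?e ` A)"
    by (metis free_space.dim_span free_space.dim_eq_card_independent)
  then show ?thesis by (simp add: card_image[OF inj])
qed

lemma subspace_tensor_power: "free_space.subspace (tensor_power n)"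
  by (rule free_space.subspaceI) (auto simp: tensor_power_def in_keys_iff dest!: subsetD[OF keys_add])

lemma evaluate_image_tensor_power:
  "evaluate ` tensor_power n =
     {t. Poly_Mapping.keys t \<subseteq> set (filter (\<lambda>w. length w = n) normal_words)}" (is "_ = ?R")
proof (intro equalityI subsetI)
  fix t :: "tetra list \<Rightarrow>\<^sub>0 'a" assume "t \<in> ?R"
  then have t: "t \<in> normal_space" "t \<in> tensor_power n" by (auto simp: normal_space_def tensor_power_def)
  have "lin_ext (\<lambda>u. Poly_Mapping.single (rev u) 1) t \<in> tensor_power n"
    using t(2) by (rule lin_ext_tensor_power) (simp add: tensor_power_def)
  then show "t \<in> evaluate ` tensor_power n" using evaluate_rev_normal[OF t(1)] by (metis imageI)
next
  fix t :: "tetra list \<Rightarrow>\<^sub>0 'a" assume "t \<in> evaluate ` tensor_power n"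
  then obtain s where "s \<in> tensor_power n" "t = evaluate s" by blast
  then show "t \<in> ?R"
    using evaluate_closed(1)[of s] evaluate_closed(2)[of s n] by (auto simp: normal_space_def tensor_power_def)
qed

lemma evaluate_range: "range evaluate = {t. Poly_Mapping.keys t \<subseteq> set normal_words}"
proof (intro equalityI subsetI)
  fix t :: "tetra list \<Rightarrow>\<^sub>0 'a" assume "t \<in> {t. Poly_Mapping.keys t \<subseteq> set normal_words}"
  then show "t \<in> range evaluate" using evaluate_rev_normal[of t] by (metis normal_space_def rangeI)
qed (use evaluate_closed in \<open>auto simp: normal_space_def\<close>)

definition homogeneous_part :: "nat \<Rightarrow> ('x list \<Rightarrow>\<^sub>0 'k::field) \<Rightarrow> ('x list \<Rightarrow>\<^sub>0 'k)" where
  "homogeneous_part n = lin_ext (\<lambda>w. if length w = n then Poly_Mapping.single w 1 else 0)"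

lemma homogeneous_part_tensor_power: "homogeneous_part n t \<in> tensor_power n"
proof -
  have "length v = n" if v: "v \<in> Poly_Mapping.keys (homogeneous_part n t)" for v
  proof -
    obtain w where "v \<in> Poly_Mapping.keys
        (scale (Poly_Mapping.lookup t w) (if length w = n then Poly_Mapping.single w 1 else 0))"
      using v unfolding homogeneous_part_def lin_ext_def by (rule keys_sum_obtain)
    then show ?thesis by (auto split: if_splits)
  qed
  then show ?thesis by (simp add: tensor_power_def)
qed

text \<open>
  The values on the homogeneous parts lie in different tensor powers and so cannot cancel.
\<close>

lemma graded_map_eq_0_iff:
  assumes "\<And>w. f w \<in> tensor_power (length w)"
  shows "lin_ext f t = 0 \<longleftrightarrow> (\<forall>n. lin_ext f (homogeneous_part n t) = 0)"
proof -
  have "Poly_Mapping.lookup (lin_ext f (homogeneous_part n t)) v =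
      (if length v = n then Poly_Mapping.lookup (lin_ext f t) v else 0)" for n v
  proof -
    have v: "Poly_Mapping.lookup (f w) v = 0" if "length w \<noteq> length v" for w
    proof (rule ccontr)
      assume "Poly_Mapping.lookup (f w) v \<noteq> 0"
      then have "v \<in> Poly_Mapping.keys (f w)" by (simp add: in_keys_iff)
      then show False using assms[of w] that by (simp add: tensor_power_def)
    qed
    have "lin_ext f (homogeneous_part n t) = lin_ext (\<lambda>w. if length w = n then f w else 0) t"
      unfolding homogeneous_part_def lin_ext_compose by (rule lin_ext_eqI) (simp add: lin_ext.zero)
    then show ?thesis
      using v by (auto simp: lin_ext_def lookup_sum intro!: sum.cong sum.neutral)
  qed
  then show ?thesis by (metis poly_mapping_eqI lookup_zero)
qed

lemma symmetrizer_tensor_power: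
  assumes "length w = n"
  shows "symmetrizer n (Poly_Mapping.single w 1) \<in> tensor_power n"
  unfolding quantum_symmetrizer_def
proof (rule free_space.subspace_sum[OF subspace_tensor_power])
  fix x assume "x \<in> {x. x permutes {..<n}}"
  then obtain ks where ks: "expression_of n x ks" "length ks = card (inversions n x)"
    using minimal_word_exists by blast
  then show "section_op tetra_braiding n x (Poly_Mapping.single w 1) \<in> tensor_power n"
    by (simp add: section_op_single[OF ks assms] assms tensor_power_def)
qed

lemma graded_symmetrizer_eq_0_iff_evaluate:
  fixes t :: "tetra list \<Rightarrow>\<^sub>0 'k::field_char_0"
  shows "graded_symmetrizer tetra_braiding t = 0 \<longleftrightarrow> evaluate t = 0"
proof -
  have "graded_symmetrizer tetra_braiding s = symmetrizer n s" if "s \<in> tensor_power n"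
    for n and s :: "tetra list \<Rightarrow>\<^sub>0 'k"
  proof -
    have "graded_symmetrizer tetra_braiding s = lin_ext (\<lambda>w. symmetrizer n (Poly_Mapping.single w 1)) s"
      unfolding graded_symmetrizer_def
      by (rule lin_ext_eqI) (use that in \<open>auto simp: tensor_power_def\<close>)
    then show ?thesis by (simp only: symmetrizer_lin_ext[symmetric])
  qed
  note deg = this[OF homogeneous_part_tensor_power]
  have sym: "symmetrizer (length w) (Poly_Mapping.single w (1 :: 'k)) \<in> tensor_power (length w)" for w
    by (rule symmetrizer_tensor_power) simp
  have "graded_symmetrizer tetra_braiding t = 0 \<longleftrightarrow> (\<forall>n. symmetrizer n (homogeneous_part n t) = 0)"
    using graded_map_eq_0_iff[of "\<lambda>w. symmetrizer (length w) (Poly_Mapping.single w (1::'k))" t, OF sym]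
    by (simp only: graded_symmetrizer_def[symmetric] deg)
  also have "\<dots> \<longleftrightarrow> (\<forall>n. evaluate (homogeneous_part n t) = 0)"
    using symmetrizer_eq_0_iff_evaluate homogeneous_part_tensor_power by blast
  also have "\<dots> \<longleftrightarrow> evaluate t = 0"
    unfolding evaluate_def using word_image_closed(2) by (intro graded_map_eq_0_iff[symmetric])
  finally show ?thesis .
qed

lemma dim_nichols_component:
  "free_space.dim (nichols_component (tetra_braiding :: _ \<Rightarrow> (_ \<Rightarrow>\<^sub>0 'k::field_char_0)) n) =
     length (filter (\<lambda>w. length w = n) normal_words)"
proof -
  have "free_space.dim (symmetrizer n ` (tensor_power n :: (_ \<Rightarrow>\<^sub>0 'k) set)) =
      free_space.dim (evaluate ` (tensor_power n :: (_ \<Rightarrow>\<^sub>0 'k) set))"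
    using symmetrizer_eq_0_iff_evaluate
    by (intro dim_image_eq_if_same_kernel symmetrizer.linear_axioms evaluate.linear_axioms
        subspace_tensor_power)
  also have "\<dots> = length (filter (\<lambda>w. length w = n) normal_words)"
    unfolding evaluate_image_tensor_power
    using dim_coordinate_subspace[of "set (filter (\<lambda>w. length w = n) normal_words)"]
      distinct_card[of "filter (\<lambda>w. length w = n) normal_words"] distinct_normal_words by simp
  finally show ?thesis by (simp add: nichols_component_def)
qed

lemma dim_nichols_algebra:
  "free_space.dim (nichols_algebra (tetra_braiding :: _ \<Rightarrow> (_ \<Rightarrow>\<^sub>0 'k::field_char_0))) = length normal_words"
proof -
  have "free_space.dim (range (graded_symmetrizer tetra_braiding :: _ \<Rightarrow> (_ \<Rightarrow>\<^sub>0 'k))) =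
      free_space.dim (range (evaluate :: _ \<Rightarrow> (_ \<Rightarrow>\<^sub>0 'k)))"
    using graded_symmetrizer_eq_0_iff_evaluate
    by (intro dim_image_eq_if_same_kernel linear_lin_ext[of "\<lambda>w. symmetrizer (length w) (Poly_Mapping.single w 1)",
          folded graded_symmetrizer_def] evaluate.linear_axioms free_space.subspace_UNIV)
  also have "\<dots> = length normal_words"
    unfolding evaluate_range
    using dim_coordinate_subspace[of "set normal_words"] distinct_card[OF distinct_normal_words] by simp
  finally show ?thesis by (simp add: nichols_algebra_def)
qed

theorem mainTheorem7:
  fixes c :: "(tetra \<times> tetra \<Rightarrow>\<^sub>0 'k::{alg_closed_field, field_char_0}) \<Rightarrow> (tetra \<times> tetra \<Rightarrow>\<^sub>0 'k)"
  assumes "c = tetra_braiding"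
  shows "map (\<lambda>i. free_space.dim (nichols_component c i)) [0..<10] =
           [1, 4, 8, 11, 12, 12, 11, 8, 4, 1] \<and>
         free_space.dim (nichols_algebra c) = 72"
  using length_filter_normal_words length_normal_words
  by (simp only: assms dim_nichols_component dim_nichols_algebra)

end
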